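(* Let $\mathbf m=(m_1,m_2,m_1',m_2',m_1'',m_2'')$ be positive integers with $d_{\mathbf m}>0$, and let $\mathbf m\mapsto \tilde{\mathbf m}$ be a transformation of the parameters obtained as a composition of the following operations on the arrangement $\mathrm{Arr}(\mathbf m)$ of two $3\times3$ squares: - permutations of the lines (rows) and permutations of the columns, performed simultaneously on the left and right $3\times 3$ squares; - transposition (as matrices), performed simultaneously on the left and right $3\times3$ squares; - exchange of the left and right $3\times 3$ squares. Then the pair of matrices $(X_{\mathbf m},Y_{\mathbf m})$ is simultaneously conjugated (by one and the same change of basis) to the pair $(\epsilon X_{\tilde{\mathbf m}},Y_{\tilde{\mathbf m}})$, where the sign $\epsilon\in\{1,-1\}$ is $(-1)$ to the power the number of exchanges of two lines or of two columns involved (i.e. the product of the signatures of the line permutations and of the column permutations used; matrix transposition and exchange of the two squares contribute no sign).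
   Context: For $\mathbf m=(m_1,m_2,m_1',m_2',m_1'',m_2'')$ put $$\ell=\tfrac13(m_1+2m_2+m_1'+2m_2'-m_1''-2m_2''),\qquad n=\tfrac13(2m_1+m_2+2m_1'+m_2'-2m_1''-m_2'').$$ The arrangement attached to $\mathbf m$ is $$\mathrm{Arr}(\mathbf m)=\left[\begin{array}{ccc|ccc} m_1 & m'_1 & m''_2 & m_1+\ell-n & m'_1+\ell-n & m''_2+\ell-n\\ m'_1+m'_2-\ell & m_1+m_2-\ell & n & m'_1+m'_2-n & m_1+m_2-n & \ell\\ m_2+n-\ell & m'_2+n-\ell & m''_1+n-\ell & m_2 & m'_2 & m''_1 \end{array}\right].$$ The arrangement determines $\mathbf m$, and each of the listed operations applied to $\mathrm{Arr}(\mathbf m)$ yields $\mathrm{Arr}(\tilde{\mathbf m})$ for a unique $\tilde{\mathbf m}$. $d_{\mathbf m}$ is the multiplicity of the irreducible $\mathfrak{su}_3$-representation $[m_1'',m_2'']$ in $[m_1,m_2]\otimes[m_1',m_2']$, where $[m_1,m_2]$ is the irreducible representation whose highest weight has Dynkin labels $(m_1-1,m_2-1)$. It is non-zero if and only if all $18$ entries of $\mathrm{Arr}(\mathbf m)$ are positive integers, in which case it is their minimum. The matrices $X_{\mathbf m},Y_{\mathbf m}$ (which represent, in a suitable basis, two generators of the centraliser of the diagonal $U(\mathfrak{su}_3)$ in $U(\mathfrak{su}_3)^{\otimes2}$ acting on the $d_{\mathbf m}$-dimensional multiplicity space) are the following. Put $(\xi_1,\xi_2,\xi_3)=(\ell,m_2,m_1'+\ell-n)$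 if $\ell\le n$ and $(\xi_1,\xi_2,\xi_3)=(n,m_1',m_2+n-\ell)$ if $n\le\ell$; $(\xi_4,\xi_5,\xi_6)=(\ell-m_2',n-m_1,0)$; $\Lambda=\sum_{i=1}^3\xi_i-\sum_{i=4}^6\xi_i+2|\ell-n|$; $\lambda_\pm=\pm\frac12\Lambda+\frac16\sum_{i=1}^6\xi_i$; $\xi_a=\min\{\xi_1,\xi_2,\xi_3\}$; $\xi_b=\max\{\xi_4,\xi_5,\xi_6\}$; then $d=d_{\mathbf m}=\xi_a-\xi_b$. $X_{\mathbf m}=(a_{ij})$ and $Y_{\mathbf m}=(b_{ij})$ are the $d\times d$ tridiagonal matrices with, for $1\le j\le d-1$, $a_{j,j+1}=\prod_{i=1}^3(j+\xi_b-\xi_i)$, $b_{j,j+1}=a_{j,j+1}(j+\xi_b-\lambda_-)$, $a_{j+1,j}=\prod_{i=4}^6(j+\xi_b-\xi_i)$, $b_{j+1,j}=a_{j+1,j}(j+\xi_b-\lambda_+)$, and, with $E_{j,k}=\sum_{i=1}^6(\xi_i-j-\xi_b+\frac12)^k$, for $1\le j\le d$, $$a_{jj}=-\tfrac1{108}\bigl(\tfrac72E_{j,1}^3-18E_{j,1}E_{j,2}+18E_{j,3}\bigr)-\tfrac1{24}E_{j,1}(\Lambda^2+2),$$ $$b_{jj}=\tfrac1{288}\bigl(\tfrac52E_{j,1}^4+32E_{j,1}E_{j,3}+6(E_{j,2}^2-3E_{j,1}^2E_{j,2}-4E_{j,4})+6E_{j,2}(\Lambda^2+2)-3E_{j,1}^2(\Lambda^2-2)-\tfrac32\Lambda^4+6\Lambda^2-36\bigr).$$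 *)

theory Defs
  imports
    "HOL-Combinatorics.Permutations"
    "Jordan_Normal_Form.Matrix"
    "Jordan_Normal_Form.VS_Connect"
    "Jordan_Normal_Form.Schur_Decomposition"
begin

text \<open>The parameters \<open>m = (m1, m2, m1', m2', m1'', m2'')\<close>.\<close>

type_synonym params = "int \<times> int \<times> int \<times> int \<times> int \<times> int"

fun positive_params :: "params \<Rightarrow> bool" where
  "positive_params (m1, m2, m1', m2', m1'', m2'') \<longleftrightarrow>
     m1 > 0 \<and> m2 > 0 \<and> m1' > 0 \<and> m2' > 0 \<and> m1'' > 0 \<and> m2'' > 0"

fun ell :: "params \<Rightarrow> real" where
  "ell (m1, m2, m1', m2', m1'', m2'') =
     (real_of_int m1 + 2 * m2 + m1' + 2 * m2' - m1'' - 2 * m2'') / 3"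

fun enn :: "params \<Rightarrow> real" where
  "enn (m1, m2, m1', m2', m1'', m2'') =
     (2 * real_of_int m1 + m2 + 2 * m1' + m2' - 2 * m1'' - m2'') / 3"


section \<open>Arrangements and the operations on them\<close>

type_synonym arrangement = "real mat \<times> real mat"

fun Arr :: "params \<Rightarrow> arrangement" where
  "Arr (m1, m2, m1', m2', m1'', m2'') =
     (let l = ell (m1, m2, m1', m2', m1'', m2'');
          n = enn (m1, m2, m1', m2', m1'', m2'')
      in (mat_of_rows_list 3
            [[real_of_int m1, real_of_int m1', real_of_int m2''],
             [m1' + m2' - l,  m1 + m2 - l,     n],
             [m2 + n - l,     m2' + n - l,     m1'' + n - l]],
          mat_of_rows_list 3
            [[m1 + l - n,     m1' + l - n,     m2'' + l - n],
             [m1' + m2' - n,  m1 + m2 - n,     l],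
             [real_of_int m2, real_of_int m2', real_of_int m1'']]))"

datatype arr_op =
    Permute_Rows "nat \<Rightarrow> nat"
  | Permute_Cols "nat \<Rightarrow> nat"
  | Transpose
  | Exchange

text \<open>Rows and columns are numbered \<open>0, 1, 2\<close>, as usual for \<^typ>\<open>'a mat\<close>.\<close>

fun valid_op :: "arr_op \<Rightarrow> bool" where
  "valid_op (Permute_Rows \<sigma>) \<longleftrightarrow> \<sigma> permutes {0..<3}"
| "valid_op (Permute_Cols \<sigma>) \<longleftrightarrow> \<sigma> permutes {0..<3}"
| "valid_op Transpose \<longleftrightarrow> True"
| "valid_op Exchange \<longleftrightarrow> True"

fun apply_op :: "arr_op \<Rightarrow> arrangement \<Rightarrow> arrangement" where
  "apply_op (Permute_Rows \<sigma>) (L, R) =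
     (mat 3 3 (\<lambda>(i, j). L $$ (\<sigma> i, j)), mat 3 3 (\<lambda>(i, j). R $$ (\<sigma> i, j)))"
| "apply_op (Permute_Cols \<sigma>) (L, R) =
     (mat 3 3 (\<lambda>(i, j). L $$ (i, \<sigma> j)), mat 3 3 (\<lambda>(i, j). R $$ (i, \<sigma> j)))"
| "apply_op Transpose (L, R) = (transpose_mat L, transpose_mat R)"
| "apply_op Exchange (L, R) = (R, L)"

fun op_sign :: "arr_op \<Rightarrow> int" where
  "op_sign (Permute_Rows \<sigma>) = sign \<sigma>"
| "op_sign (Permute_Cols \<sigma>) = sign \<sigma>"
| "op_sign Transpose = 1"
| "op_sign Exchange = 1"

text \<open>A composition is a list of operations, performed from left to right.\<close>

definition apply_ops :: "arr_op list \<Rightarrow> arrangement \<Rightarrow> arrangement" where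
  "apply_ops ops A = fold apply_op ops A"

definition ops_sign :: "arr_op list \<Rightarrow> int" where
  "ops_sign ops = prod_list (map op_sign ops)"


section \<open>Representations of su(3) and tensor product multiplicities\<close>

definition su3 :: "complex mat set" where
  "su3 = {A \<in> carrier_mat 3 3. mat_adjoint A = - A \<and> (\<Sum>i<3. A $$ (i, i)) = 0}"

text \<open>Representations of the real Lie algebra su(3) on the complex space of column
  vectors of dimension \<open>N\<close>; only the values of \<open>\<rho>\<close> on \<^const>\<open>su3\<close> matter.\<close>

definition su3_rep :: "nat \<Rightarrow> (complex mat \<Rightarrow> complex mat) \<Rightarrow> bool" where
  "su3_rep N \<rho> \<longleftrightarrow>
     (\<forall>A\<in>su3. \<rho> A \<in> carrier_mat N N) \<and>
     (\<forall>A\<in>su3. \<forall>B\<in>su3. \<rho> (A + B) = \<rho> A + \<rho> B) \<and>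
     (\<forall>A\<in>su3. \<forall>r::real. \<rho> (complex_of_real r \<cdot>\<^sub>m A) = complex_of_real r \<cdot>\<^sub>m \<rho> A) \<and>
     (\<forall>A\<in>su3. \<forall>B\<in>su3. \<rho> (A * B - B * A) = \<rho> A * \<rho> B - \<rho> B * \<rho> A)"

definition su3_irreducible :: "nat \<Rightarrow> (complex mat \<Rightarrow> complex mat) \<Rightarrow> bool" where
  "su3_irreducible N \<rho> \<longleftrightarrow> su3_rep N \<rho> \<and> N > 0 \<and>
     (\<forall>W. VectorSpace.subspace class_ring W (module_vec TYPE(complex) N) \<longrightarrow>
          (\<forall>A\<in>su3. \<forall>w\<in>W. \<rho> A *\<^sub>v w \<in> W) \<longrightarrow>
          W = {0\<^sub>v N} \<or> W = carrier_vec N)"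

text \<open>The complex-linear extension of \<open>\<rho>\<close> to the traceless matrices, via the decomposition
  \<open>A = U + \<i> V\<close> with \<open>U = (A - A*) / 2\<close> and \<open>V = - \<i> (A + A*) / 2\<close> in su(3).\<close>

definition complexify ::
  "(complex mat \<Rightarrow> complex mat) \<Rightarrow> complex mat \<Rightarrow> complex mat" where
  "complexify \<rho> A =
     \<rho> ((1 / 2) \<cdot>\<^sub>m (A - mat_adjoint A)) + \<i> \<cdot>\<^sub>m \<rho> ((- \<i> / 2) \<cdot>\<^sub>m (A + mat_adjoint A))"

definition unit_mat3 :: "nat \<Rightarrow> nat \<Rightarrow> complex mat" where
  "unit_mat3 i j = mat 3 3 (\<lambda>(r, s). if r = i \<and> s = j then 1 else 0)"

text \<open>\<open>v\<close> is a highest weight vector whose weight has Dynkin labels \<open>(p, q)\<close>.\<close>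

definition highest_weight_vector ::
  "nat \<Rightarrow> (complex mat \<Rightarrow> complex mat) \<Rightarrow> int \<Rightarrow> int \<Rightarrow> complex vec \<Rightarrow> bool" where
  "highest_weight_vector N \<rho> p q v \<longleftrightarrow>
     v \<in> carrier_vec N \<and> v \<noteq> 0\<^sub>v N \<and>
     (\<forall>i j. i < j \<and> j < 3 \<longrightarrow> complexify \<rho> (unit_mat3 i j) *\<^sub>v v = 0\<^sub>v N) \<and>
     complexify \<rho> (unit_mat3 0 0 - unit_mat3 1 1) *\<^sub>v v = of_int p \<cdot>\<^sub>v v \<and>
     complexify \<rho> (unit_mat3 1 1 - unit_mat3 2 2) *\<^sub>v v = of_int q \<cdot>\<^sub>v v"

text \<open>\<open>(N, \<rho>)\<close> is a model of the representation \<open>[m1, m2]\<close>; note the shift by one.\<close>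

definition is_irrep ::
  "int \<Rightarrow> int \<Rightarrow> nat \<Rightarrow> (complex mat \<Rightarrow> complex mat) \<Rightarrow> bool" where
  "is_irrep m1 m2 N \<rho> \<longleftrightarrow> su3_irreducible N \<rho> \<and>
     (\<exists>v. highest_weight_vector N \<rho> (m1 - 1) (m2 - 1) v)"

definition kronecker :: "complex mat \<Rightarrow> complex mat \<Rightarrow> complex mat" where
  "kronecker A B = mat (dim_row A * dim_row B) (dim_col A * dim_col B)
     (\<lambda>(i, j). A $$ (i div dim_row B, j div dim_col B) * B $$ (i mod dim_row B, j mod dim_col B))"

definition tensor_rep ::
  "nat \<Rightarrow> (complex mat \<Rightarrow> complex mat) \<Rightarrow> nat \<Rightarrow> (complex mat \<Rightarrow> complex mat) \<Rightarrow>
   complex mat \<Rightarrow> complex mat" where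
  "tensor_rep N \<rho> N' \<rho>' A = kronecker (\<rho> A) (1\<^sub>m N') + kronecker (1\<^sub>m N) (\<rho>' A)"

definition intertwiners ::
  "nat \<Rightarrow> (complex mat \<Rightarrow> complex mat) \<Rightarrow> nat \<Rightarrow> (complex mat \<Rightarrow> complex mat) \<Rightarrow> complex mat set"
  where
  "intertwiners K \<tau> N \<rho> = {T \<in> carrier_mat N K. \<forall>A\<in>su3. T * \<tau> A = \<rho> A * T}"

text \<open>The multiplicity of an irreducible \<open>\<tau>\<close> in \<open>\<rho>\<close> is the dimension of the multiplicity
  space \<open>Hom(\<tau>, \<rho>)\<close>.\<close>

definition multiplicity_in ::
  "nat \<Rightarrow> (complex mat \<Rightarrow> complex mat) \<Rightarrow> nat \<Rightarrow> (complex mat \<Rightarrow> complex mat) \<Rightarrow> nat" where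
  "multiplicity_in K \<tau> N \<rho> =
     vectorspace.dim class_ring
       ((module_mat TYPE(complex) N K)\<lparr>carrier := intertwiners K \<tau> N \<rho>\<rparr>)"

text \<open>\<open>tensor_multiplicity m d\<close> says that \<open>d\<close> is the multiplicity of \<open>[m1'', m2'']\<close> in
  the tensor product of \<open>[m1, m2]\<close> and \<open>[m1', m2']\<close>. The three representations exist and are
  unique up to isomorphism for positive \<open>m\<close>, so that \<open>d\<close> is then determined by \<open>m\<close>.\<close>

fun tensor_multiplicity :: "params \<Rightarrow> nat \<Rightarrow> bool" where
  "tensor_multiplicity (m1, m2, m1', m2', m1'', m2'') d \<longleftrightarrow>
     (\<exists>N \<rho> N' \<rho>' N'' \<rho>''.
        is_irrep m1 m2 N \<rho> \<and> is_irrep m1' m2' N' \<rho>' \<and> is_irrep m1'' m2'' N'' \<rho>'' \<and>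
        d = multiplicity_in N'' \<rho>'' (N * N') (tensor_rep N \<rho> N' \<rho>'))"


section \<open>The matrices X and Y\<close>

text \<open>\<open>xi m i\<close> is meaningful for \<open>1 \<le> i \<le> 6\<close>.\<close>

fun xi :: "params \<Rightarrow> nat \<Rightarrow> real" where
  "xi (m1, m2, m1', m2', m1'', m2'') i =
     (let l = ell (m1, m2, m1', m2', m1'', m2'');
          n = enn (m1, m2, m1', m2', m1'', m2'')
      in ((if l \<le> n then [l, m2, m1' + l - n] else [n, m1', m2 + n - l])
          @ [l - m2', n - m1, 0]) ! (i - 1))"

definition Lam :: "params \<Rightarrow> real" where
  "Lam m = (\<Sum>i=1..3. xi m i) - (\<Sum>i=4..6. xi m i) + 2 * \<bar>ell m - enn m\<bar>"

definition lam_plus :: "params \<Rightarrow> real" where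
  "lam_plus m = Lam m / 2 + (\<Sum>i=1..6. xi m i) / 6"

definition lam_minus :: "params \<Rightarrow> real" where
  "lam_minus m = - Lam m / 2 + (\<Sum>i=1..6. xi m i) / 6"

definition xi_a :: "params \<Rightarrow> real" where
  "xi_a m = Min (xi m ` {1..3})"

definition xi_b :: "params \<Rightarrow> real" where
  "xi_b m = Max (xi m ` {4..6})"

text \<open>The size \<open>\<xi>\<^sub>a - \<xi>\<^sub>b\<close> of the matrices, an integer if \<open>\<ell>\<close> and \<open>n\<close> are.\<close>

definition msize :: "params \<Rightarrow> nat" where
  "msize m = nat \<lfloor>xi_a m - xi_b m\<rfloor>"

definition E :: "params \<Rightarrow> nat \<Rightarrow> nat \<Rightarrow> real" where
  "E m j k = (\<Sum>i=1..6. (xi m i - real j - xi_b m + 1 / 2) ^ k)"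

text \<open>The entries, indexed from one: \<open>upper j\<close> is the entry at \<open>(j, j + 1)\<close>, \<open>lower j\<close> the one
  at \<open>(j + 1, j)\<close> and \<open>diag j\<close> the one at \<open>(j, j)\<close>.\<close>

definition a_upper :: "params \<Rightarrow> nat \<Rightarrow> real" where
  "a_upper m j = (\<Prod>i=1..3. real j + xi_b m - xi m i)"

definition a_lower :: "params \<Rightarrow> nat \<Rightarrow> real" where
  "a_lower m j = (\<Prod>i=4..6. real j + xi_b m - xi m i)"

definition b_upper :: "params \<Rightarrow> nat \<Rightarrow> real" where
  "b_upper m j = a_upper m j * (real j + xi_b m - lam_minus m)"

definition b_lower :: "params \<Rightarrow> nat \<Rightarrow> real" where
  "b_lower m j = a_lower m j * (real j + xi_b m - lam_plus m)"

definition a_diag :: "params \<Rightarrow> nat \<Rightarrow> real" where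
  "a_diag m j =
     - (1 / 108) * ((7 / 2) * (E m j 1) ^ 3 - 18 * E m j 1 * E m j 2 + 18 * E m j 3)
     - (1 / 24) * E m j 1 * ((Lam m)\<^sup>2 + 2)"

definition b_diag :: "params \<Rightarrow> nat \<Rightarrow> real" where
  "b_diag m j =
     (1 / 288) *
     ((5 / 2) * (E m j 1) ^ 4 + 32 * E m j 1 * E m j 3
      + 6 * ((E m j 2)\<^sup>2 - 3 * (E m j 1)\<^sup>2 * E m j 2 - 4 * E m j 4)
      + 6 * E m j 2 * ((Lam m)\<^sup>2 + 2)
      - 3 * (E m j 1)\<^sup>2 * ((Lam m)\<^sup>2 - 2)
      - (3 / 2) * (Lam m) ^ 4 + 6 * (Lam m)\<^sup>2 - 36)"

text \<open>Positions of \<^typ>\<open>'a mat\<close> are counted from zero, hence the shifts by one.\<close>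

definition tridiagonal ::
  "nat \<Rightarrow> (nat \<Rightarrow> real) \<Rightarrow> (nat \<Rightarrow> real) \<Rightarrow> (nat \<Rightarrow> real) \<Rightarrow> complex mat" where
  "tridiagonal d lower diag upper = mat d d (\<lambda>(r, s).
     if s = r + 1 then complex_of_real (upper (r + 1))
     else if r = s + 1 then complex_of_real (lower (s + 1))
     else if r = s then complex_of_real (diag (r + 1))
     else 0)"

definition X_mat :: "params \<Rightarrow> complex mat" where
  "X_mat m = tridiagonal (msize m) (a_lower m) (a_diag m) (a_upper m)"

definition Y_mat :: "params \<Rightarrow> complex mat" where
  "Y_mat m = tridiagonal (msize m) (b_lower m) (b_diag m) (b_upper m)"

end

theory Submission
  imports Defs
begin

text \<open>The entries of the smaller of the two squares are the differences \<open>\<xi>\<^sub>i - \<xi>\<^sub>j\<close> with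
  \<open>i \<le> 3 < j\<close>, and the other square differs from it by the constant \<open>\<bar>\<ell> - n\<bar>\<close>. So the operations act by
  permuting \<open>\<xi>\<^sub>1, \<xi>\<^sub>2, \<xi>\<^sub>3\<close> and \<open>\<xi>\<^sub>4, \<xi>\<^sub>5, \<xi>\<^sub>6\<close>, which changes neither \<open>X\<close> nor \<open>Y\<close>, by a common
  translation, which changes neither of them since only differences occur, and, for an odd number of
  exchanges of lines or columns, by \<open>\<xi>\<^sub>i \<mapsto> - \<xi>\<^sub>i\<^sub>\<plusminus>\<^sub>3\<close>. The latter reverses the order of the
  basis and changes the sign of \<open>X\<close>, provided that \<open>\<xi>\<^sub>a - \<xi>\<^sub>b\<close> is exactly the size of the matrices,
  that is, an integer. This integrality comes from the multiplicity being non-zero: \<open>\<i> diag(1, 1, -2)\<close>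
  acts on \<open>[p, q]\<close> with eigenvalues in \<open>\<i> (p + 2 q + 3 \<int>)\<close>, so a non-zero intertwiner forces
  \<open>m1 + 2 m2 + m1' + 2 m2' - m1'' - 2 m2''\<close> to be divisible by 3.\<close>

section \<open>Triality\<close>

lemma smult_mat_mult_vec:
  fixes F :: "'a :: comm_semiring_0 mat"
  assumes "F \<in> carrier_mat n m" "v \<in> carrier_vec m"
  shows "(c \<cdot>\<^sub>m F) *\<^sub>v v = c \<cdot>\<^sub>v (F *\<^sub>v v)"
  using assms by (intro eq_vecI) (auto simp: scalar_prod_def sum_distrib_left mult.assoc)

text \<open>The sum of the eigenspaces of \<open>U\<close> for the eigenvalues in \<open>K\<close>.
  Adding one eigenvector at a time yields an induction rule that reduces linear statements to single
  eigenvectors.\<close>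

inductive_set eigen_span :: "nat \<Rightarrow> complex mat \<Rightarrow> complex set \<Rightarrow> complex vec set"
  for N U K where
  zero: "0\<^sub>v N \<in> eigen_span N U K"
| add: "w \<in> eigen_span N U K \<Longrightarrow> u \<in> carrier_vec N \<Longrightarrow> \<mu> \<in> K \<Longrightarrow> U *\<^sub>v u = \<mu> \<cdot>\<^sub>v u \<Longrightarrow>
     w + u \<in> eigen_span N U K"

lemma eigen_span_carrier: "w \<in> eigen_span N U K \<Longrightarrow> w \<in> carrier_vec N"
  by (induction rule: eigen_span.induct) auto

lemma eigenvector_in_eigen_span:
  assumes "u \<in> carrier_vec N" "\<mu> \<in> K" "U *\<^sub>v u = \<mu> \<cdot>\<^sub>v u"
  shows "u \<in> eigen_span N U K"
  using eigen_span.add[OF eigen_span.zero assms] assms(1) by simp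

lemma eigen_span_add:
  assumes "v \<in> eigen_span N U K" "w \<in> eigen_span N U K"
  shows "w + v \<in> eigen_span N U K"
  using assms(1)
proof (induction rule: eigen_span.induct)
  case zero
  then show ?case using assms(2) eigen_span_carrier[OF assms(2)] by simp
next
  case (add v u \<mu>)
  have "w + (v + u) = (w + v) + u"
    using eigen_span_carrier[OF assms(2)] eigen_span_carrier[OF add(1)] add(2)
    by (simp add: assoc_add_vec[of _ N])
  then show ?case using eigen_span.add[OF add.IH add(2-4)] by simp
qed

text \<open>By linearity eigenvectors suffice; their images may be sums of eigenvectors, as happens
  for the image of an element of su(3).\<close>

lemma eigen_span_mult_mat:
  assumes "w \<in> eigen_span N U K" "F \<in> carrier_mat N N"
    and "\<And>u \<mu>. u \<in> carrier_vec N \<Longrightarrow> \<mu> \<in> K \<Longrightarrow> U *\<^sub>v u = \<mu> \<cdot>\<^sub>v u \<Longrightarrow>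
       F *\<^sub>v u \<in> eigen_span N U K"
  shows "F *\<^sub>v w \<in> eigen_span N U K"
  using assms(1)
proof (induction rule: eigen_span.induct)
  case zero
  have "F *\<^sub>v 0\<^sub>v N = 0\<^sub>v N" using assms(2) by auto
  then show ?case using eigen_span.zero by simp
next
  case (add v u \<mu>)
  have "F *\<^sub>v (v + u) = F *\<^sub>v v + F *\<^sub>v u"
    using eigen_span_carrier[OF add(1)] add(2) assms(2) by (simp add: mult_add_distrib_mat_vec)
  then show ?case using eigen_span_add[OF assms(3)[OF add(2-4)] add.IH] by simp
qed

lemma eigen_span_smult:
  assumes "w \<in> eigen_span N U K" "U \<in> carrier_mat N N"
  shows "c \<cdot>\<^sub>v w \<in> eigen_span N U K"
proof -
  \<comment> \<open>Scaling is written as a matrix so that \<open>eigen_span_mult_mat\<close>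
    applies.\<close>
  have eq: "(c \<cdot>\<^sub>m 1\<^sub>m N) *\<^sub>v v = c \<cdot>\<^sub>v v" if "v \<in> carrier_vec N" for v :: "complex vec"
    using that by (auto simp: smult_mat_mult_vec[of _ N N])
  have "(c \<cdot>\<^sub>m 1\<^sub>m N) *\<^sub>v w \<in> eigen_span N U K"
  proof (rule eigen_span_mult_mat[OF assms(1)])
    fix u \<mu> assume u: "u \<in> carrier_vec N" "\<mu> \<in> K" "U *\<^sub>v u = \<mu> \<cdot>\<^sub>v u"
    have "U *\<^sub>v (c \<cdot>\<^sub>v u) = \<mu> \<cdot>\<^sub>v (c \<cdot>\<^sub>v u)"
      using u assms(2) by (simp add: mult_mat_vec[of _ N N] smult_smult_assoc mult.commute)
    then show "(c \<cdot>\<^sub>m 1\<^sub>m N) *\<^sub>v u \<in> eigen_span N U K"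
      using u eq[of u] by (auto intro: eigenvector_in_eigen_span[of _ _ \<mu>])
  qed auto
  then show ?thesis using eq[OF eigen_span_carrier[OF assms(1)]] by simp
qed

text \<open>Irreducibility can only be applied to subspaces in this sense.\<close>

lemma eigen_span_subspace:
  assumes "U \<in> carrier_mat N N"
  shows "VectorSpace.subspace class_ring (eigen_span N U K) (module_vec TYPE(complex) N)"
  using vec_vs[where 'a=complex and n=N] vec_module[where 'a=complex and n=N]
    eigen_span.zero[of N U K] assms
  by (auto simp: VectorSpace.subspace_def LinearCombinations.submodule_def module_vec_simps
      eigen_span_carrier eigen_span_add intro: eigen_span_smult)

section \<open>The hypercharge element and its adjoint action on su(3)\<close>

definition hypercharge_eigenvalue :: "nat \<Rightarrow> complex" where
  "hypercharge_eigenvalue i = (if i = 2 then - 2 * \<i> else \<i>)"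

text \<open>The matrix \<open>\<i> diag(1, 1, -2)\<close>. The exponential of
  \<open>2 \<pi> / 3\<close> times it is a scalar matrix in the centre of SU(3), which is why its
  eigenvalues detect a class modulo 3.\<close>

definition hypercharge :: "complex mat" where
  "hypercharge = mat 3 3 (\<lambda>(i, j). if i = j then hypercharge_eigenvalue i else 0)"

lemma hypercharge_su3: "hypercharge \<in> su3"
  by (auto simp: su3_def hypercharge_def hypercharge_eigenvalue_def mat_adjoint_def
      mat_of_rows_def eval_nat_numeral intro!: eq_matI)

lemma su3_carrier: "A \<in> su3 \<Longrightarrow> A \<in> carrier_mat 3 3"
  by (simp add: su3_def)

lemma mat_adjoint_index:
  "i < dim_col A \<Longrightarrow> j < dim_row A \<Longrightarrow> mat_adjoint A $$ (i, j) = conjugate (A $$ (j, i))"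
  by (simp add: mat_adjoint_def mat_of_rows_def)

lemma dim_mat_adjoint [simp]: "dim_row (mat_adjoint A) = dim_col A" "dim_col (mat_adjoint A) = dim_row A"
  by (simp_all add: mat_adjoint_def)

lemma mat_adjoint_carrier: "A \<in> carrier_mat n m \<Longrightarrow> mat_adjoint A \<in> carrier_mat m n"
  by (auto simp: mat_adjoint_def)

lemma hypercharge_commutator:
  assumes "A \<in> carrier_mat 3 3"
  shows "hypercharge * A - A * hypercharge =
    mat 3 3 (\<lambda>(i, j). (hypercharge_eigenvalue i - hypercharge_eigenvalue j) * A $$ (i, j))"
proof (rule eq_matI)
  fix i j
  assume "i < dim_row (mat 3 3 (\<lambda>(i, j). (hypercharge_eigenvalue i - hypercharge_eigenvalue j) * A $$ (i, j)))"
    "j < dim_col (mat 3 3 (\<lambda>(i, j). (hypercharge_eigenvalue i - hypercharge_eigenvalue j) * A $$ (i, j)))"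
  then have "i < 3" "j < 3" by auto
  then show "(hypercharge * A - A * hypercharge) $$ (i, j) =
     mat 3 3 (\<lambda>(i, j). (hypercharge_eigenvalue i - hypercharge_eigenvalue j) * A $$ (i, j)) $$ (i, j)"
    using assms by (auto simp: hypercharge_def scalar_prod_def if_distribR sum.If_cases algebra_simps
        cong: if_cong) (auto simp: if_distrib[of "\<lambda>x. x * _"] if_distrib[of "(*) _"] cong: if_cong)
qed (use assms in \<open>auto simp: hypercharge_def\<close>)

text \<open>The scaling factors are imaginary and antisymmetric in \<open>i\<close> and
  \<open>j\<close>, so skew-Hermitian matrices remain skew-Hermitian; they vanish on the diagonal,
  hence so does the trace.\<close>

lemma hypercharge_commutator_su3:
  assumes "A \<in> su3"
  shows "hypercharge * A - A * hypercharge \<in> su3"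
proof -
  have A: "A \<in> carrier_mat 3 3" and adj: "mat_adjoint A = - A"
    using assms by (auto simp: su3_def)
  have cnj: "cnj (A $$ (j, i)) = - A $$ (i, j)" if "i < 3" "j < 3" for i j
    using arg_cong[OF adj, of "\<lambda>M. M $$ (i, j)"] that A by (simp add: mat_adjoint_index)
  show ?thesis
    unfolding hypercharge_commutator[OF A] su3_def
    by (auto simp: mat_adjoint_index cnj hypercharge_eigenvalue_def intro!: eq_matI)
qed

text \<open>The factors 0 and \<open>\<plusminus> 3 \<i>\<close> are the roots of
  \<open>x ^ 3 = - 9 * x\<close>. The scalar is a real number because representations here are only
  real-linear.\<close>

lemma hypercharge_commutator_cubed:
  assumes "A \<in> carrier_mat 3 3"
  defines "C \<equiv> hypercharge * A - A * hypercharge"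
  defines "C' \<equiv> hypercharge * C - C * hypercharge"
  shows "hypercharge * C' - C' * hypercharge = complex_of_real (- 9) \<cdot>\<^sub>m C"
proof -
  have C: "C \<in> carrier_mat 3 3" "C' \<in> carrier_mat 3 3"
    unfolding C_def C'_def hypercharge_commutator[OF assms(1)] by (auto simp: hypercharge_def)
  have 1: "C = mat 3 3 (\<lambda>(i, j). (hypercharge_eigenvalue i - hypercharge_eigenvalue j) * A $$ (i, j))"
    unfolding C_def by (rule hypercharge_commutator[OF assms(1)])
  have 2: "C' = mat 3 3 (\<lambda>(i, j). (hypercharge_eigenvalue i - hypercharge_eigenvalue j) * C $$ (i, j))"
    unfolding C'_def by (rule hypercharge_commutator[OF C(1)])
  show ?thesis
    unfolding hypercharge_commutator[OF C(2)]
    by (rule eq_matI) (auto simp: 2 1 hypercharge_eigenvalue_def)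
qed

section \<open>Hypercharge eigenvalues in irreducible representations\<close>

lemma su3_repD:
  assumes "su3_rep N \<rho>" "A \<in> su3"
  shows "\<rho> A \<in> carrier_mat N N"
    and "B \<in> su3 \<Longrightarrow> \<rho> (A + B) = \<rho> A + \<rho> B"
    and "\<rho> (complex_of_real r \<cdot>\<^sub>m A) = complex_of_real r \<cdot>\<^sub>m \<rho> A"
    and "B \<in> su3 \<Longrightarrow> \<rho> (A * B - B * A) = \<rho> A * \<rho> B - \<rho> B * \<rho> A"
  using assms by (simp_all add: su3_rep_def)

lemma su3_rep_zero:
  assumes "su3_rep N \<rho>" shows "\<rho> (0\<^sub>m 3 3) = 0\<^sub>m N N"
proof -
  have "\<rho> (complex_of_real 0 \<cdot>\<^sub>m hypercharge) = complex_of_real 0 \<cdot>\<^sub>m \<rho> hypercharge"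
    and c: "\<rho> hypercharge \<in> carrier_mat N N"
    using assms hypercharge_su3 unfolding su3_rep_def by blast+
  moreover have "complex_of_real 0 \<cdot>\<^sub>m hypercharge = 0\<^sub>m 3 3"
    by (auto simp: hypercharge_def)
  moreover have "complex_of_real 0 \<cdot>\<^sub>m \<rho> hypercharge = 0\<^sub>m N N"
    using c by auto
  ultimately show ?thesis by simp
qed

text \<open>A coset of \<open>3 \<i> \<int>\<close>, hence stable under all shifts of hypercharge
  eigenvalues that su(3) can cause.\<close>

definition triality_class :: "int \<Rightarrow> complex set" where
  "triality_class k = {\<i> * of_int (k + 3 * s) | s. True}"

lemma triality_class_shift:
  assumes "\<mu> \<in> triality_class k"
  shows "\<mu> + 3 * \<i> \<in> triality_class k" "\<mu> - 3 * \<i> \<in> triality_class k"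
proof -
  obtain s where s: "\<mu> = \<i> * of_int (k + 3 * s)" using assms by (auto simp: triality_class_def)
  have "\<mu> + 3 * \<i> = \<i> * of_int (k + 3 * (s + 1))" "\<mu> - 3 * \<i> = \<i> * of_int (k + 3 * (s - 1))"
    by (simp_all add: s algebra_simps)
  then show "\<mu> + 3 * \<i> \<in> triality_class k" "\<mu> - 3 * \<i> \<in> triality_class k"
    unfolding triality_class_def by blast+
qed

lemma commutator_eigenvector:
  fixes U F :: "complex mat"
  assumes "U \<in> carrier_mat N N" "F \<in> carrier_mat N N" "u \<in> carrier_vec N" "U *\<^sub>v u = \<mu> \<cdot>\<^sub>v u"
  shows "U *\<^sub>v (F *\<^sub>v u) = \<mu> \<cdot>\<^sub>v (F *\<^sub>v u) + (U * F - F * U) *\<^sub>v u"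
proof -
  have "(U * F - F * U) *\<^sub>v u = U *\<^sub>v (F *\<^sub>v u) - F *\<^sub>v (U *\<^sub>v u)"
    using assms by (simp add: minus_mult_distrib_mat_vec[of _ N N])
  also have "F *\<^sub>v (U *\<^sub>v u) = \<mu> \<cdot>\<^sub>v (F *\<^sub>v u)"
    using assms by (simp add: mult_mat_vec)
  finally show ?thesis using assms by (intro eq_vecI) auto
qed

text \<open>\<open>ad U\<close> is annihilated by \<open>x (x - 3 \<i>) (x + 3 \<i>)\<close> on the image of the representation, so an
  eigenvector for \<open>\<mu>\<close> is mapped into the sum of the eigenspaces for \<open>\<mu>\<close> and \<open>\<mu> \<plusminus> 3 \<i>\<close>.\<close>

lemma su3_rep_eigen_span_invariant:
  assumes rep: "su3_rep N \<rho>" and A: "A \<in> su3"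
    and w: "w \<in> eigen_span N (\<rho> hypercharge) (triality_class k)"
  shows "\<rho> A *\<^sub>v w \<in> eigen_span N (\<rho> hypercharge) (triality_class k)"
proof (rule eigen_span_mult_mat[OF w])
  let ?U = "\<rho> hypercharge" and ?W = "eigen_span N (\<rho> hypercharge) (triality_class k)"
  have comm: "\<rho> (hypercharge * B - B * hypercharge) = ?U * \<rho> B - \<rho> B * ?U" if "B \<in> su3" for B
    using rep that hypercharge_su3 unfolding su3_rep_def by blast
  have carr: "\<rho> B \<in> carrier_mat N N" if "B \<in> su3" for B
    using rep that unfolding su3_rep_def by blast
  define C where "C = hypercharge * A - A * hypercharge"
  define C' where "C' = hypercharge * C - C * hypercharge"
  have C: "C \<in> su3" "C' \<in> su3"
    unfolding C'_def C_def by (intro hypercharge_commutator_su3 A)+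
  show "\<rho> A \<in> carrier_mat N N" using carr[OF A] .
  have c: "\<rho> C = ?U * \<rho> A - \<rho> A * ?U" "\<rho> C' = ?U * \<rho> C - \<rho> C * ?U"
    using comm[OF A] comm[OF C(1)] by (simp_all add: C_def C'_def)
  have "\<rho> (hypercharge * C' - C' * hypercharge) = \<rho> (complex_of_real (- 9) \<cdot>\<^sub>m C)"
    using hypercharge_commutator_cubed[OF su3_carrier[OF A]] by (simp add: C_def C'_def)
  also have "\<dots> = complex_of_real (- 9) \<cdot>\<^sub>m \<rho> C"
    by (rule su3_repD(3)[OF rep C(1)])
  finally have c3: "?U * \<rho> C' - \<rho> C' * ?U = complex_of_real (- 9) \<cdot>\<^sub>m \<rho> C"
    using comm[OF C(2)] by simp
  fix u \<mu> assume u: "u \<in> carrier_vec N" "\<mu> \<in> triality_class k" "?U *\<^sub>v u = \<mu> \<cdot>\<^sub>v u"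
  note U = carr[OF hypercharge_su3]
  define x y z where "x = \<rho> A *\<^sub>v u" and "y = \<rho> C *\<^sub>v u" and "z = \<rho> C' *\<^sub>v u"
  have xyz: "x \<in> carrier_vec N" "y \<in> carrier_vec N" "z \<in> carrier_vec N"
    using carr[OF A] carr[OF C(1)] carr[OF C(2)] u(1) by (auto simp: x_def y_def z_def)
  have Ux: "?U *\<^sub>v x = \<mu> \<cdot>\<^sub>v x + y" and Uy: "?U *\<^sub>v y = \<mu> \<cdot>\<^sub>v y + z"
    using commutator_eigenvector[OF U carr[OF A] u(1,3)]
      commutator_eigenvector[OF U carr[OF C(1)] u(1,3)] by (simp_all add: x_def y_def z_def c)
  have Uz: "?U *\<^sub>v z = \<mu> \<cdot>\<^sub>v z + (- 9) \<cdot>\<^sub>v y"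
    using commutator_eigenvector[OF U carr[OF C(2)] u(1,3)] c3 carr[OF C(1)] u(1)
    by (simp add: y_def z_def smult_mat_mult_vec[of _ N N])
  have lin: "?U *\<^sub>v (a \<cdot>\<^sub>v x + b \<cdot>\<^sub>v y + e \<cdot>\<^sub>v z) =
     a \<cdot>\<^sub>v (?U *\<^sub>v x) + b \<cdot>\<^sub>v (?U *\<^sub>v y) + e \<cdot>\<^sub>v (?U *\<^sub>v z)" for a b e
    using U xyz by (simp add: mult_add_distrib_mat_vec[of _ N N] mult_mat_vec[of _ N N]
        assoc_add_vec[of _ N])
  \<comment> \<open>The three equations say that \<open>(a, b, e)\<close> is an eigenvector for
    \<open>\<nu>\<close> of the matrix by which \<open>\<rho> hypercharge\<close> acts on the formal
    combinations of \<open>x\<close>, \<open>y\<close>, \<open>z\<close>.\<close>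
  have eig: "a \<cdot>\<^sub>v x + b \<cdot>\<^sub>v y + e \<cdot>\<^sub>v z \<in> ?W"
    if "\<nu> \<in> triality_class k" "\<nu> * a = \<mu> * a" "\<nu> * b = \<mu> * b + a - 9 * e" "\<nu> * e = \<mu> * e + b"
    for a b e \<nu>
  proof (rule eigenvector_in_eigen_span[OF _ that(1)])
    have eq: "a * (\<mu> * p + q) + b * (\<mu> * q + r) + e * (\<mu> * r - 9 * q)
      = \<nu> * (a * p + b * q + e * r)" for p q r
    proof -
      have "\<nu> * (a * p + b * q + e * r) = (\<nu> * a) * p + (\<nu> * b) * q + (\<nu> * e) * r"
        by (simp add: algebra_simps)
      then show ?thesis unfolding that(2-4) by (simp add: algebra_simps)
    qed
    show "?U *\<^sub>v (a \<cdot>\<^sub>v x + b \<cdot>\<^sub>v y + e \<cdot>\<^sub>v z) = \<nu> \<cdot>\<^sub>v (a \<cdot>\<^sub>v x + b \<cdot>\<^sub>v y + e \<cdot>\<^sub>v z)"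
      unfolding lin Ux Uy Uz using xyz eq by (intro eq_vecI) auto
  qed (use xyz in auto)
  \<comment> \<open>The coefficients are those of the Lagrange polynomials for the nodes 0,
    \<open>3 \<i>\<close>, \<open>- 3 \<i>\<close>, evaluated at the adjoint action. Their sum is 1,
    so the three vectors add up to \<open>x\<close>.\<close>
  have e1: "1 \<cdot>\<^sub>v x + 0 \<cdot>\<^sub>v y + (1/9) \<cdot>\<^sub>v z \<in> ?W"
    by (rule eig[OF u(2)]) auto
  have e2: "0 \<cdot>\<^sub>v x + (- \<i> / 6) \<cdot>\<^sub>v y + (- 1 / 18) \<cdot>\<^sub>v z \<in> ?W"
    by (rule eig[OF triality_class_shift(1)[OF u(2)]]) (auto simp: field_simps)
  have e3: "0 \<cdot>\<^sub>v x + (\<i> / 6) \<cdot>\<^sub>v y + (- 1 / 18) \<cdot>\<^sub>v z \<in> ?W"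
    by (rule eig[OF triality_class_shift(2)[OF u(2)]]) (auto simp: field_simps)
  have "(0 \<cdot>\<^sub>v x + (\<i> / 6) \<cdot>\<^sub>v y + (- 1 / 18) \<cdot>\<^sub>v z) +
     ((0 \<cdot>\<^sub>v x + (- \<i> / 6) \<cdot>\<^sub>v y + (- 1 / 18) \<cdot>\<^sub>v z) + (1 \<cdot>\<^sub>v x + 0 \<cdot>\<^sub>v y + (1/9) \<cdot>\<^sub>v z)) \<in> ?W"
    by (rule eigen_span_add[OF eigen_span_add[OF e1 e2] e3])
  also have "(0 \<cdot>\<^sub>v x + (\<i> / 6) \<cdot>\<^sub>v y + (- 1 / 18) \<cdot>\<^sub>v z) +
     ((0 \<cdot>\<^sub>v x + (- \<i> / 6) \<cdot>\<^sub>v y + (- 1 / 18) \<cdot>\<^sub>v z) + (1 \<cdot>\<^sub>v x + 0 \<cdot>\<^sub>v y + (1/9) \<cdot>\<^sub>v z)) = x"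
    using xyz by (intro eq_vecI) (auto simp: algebra_simps)
  finally show "\<rho> A *\<^sub>v u \<in> ?W" unfolding x_def .
qed

text \<open>Here \<open>A\<close> is Hermitian, so the first summand of \<open>complexify\<close>
  vanishes. The factor \<open>\<i>\<close> cannot be pulled out of \<open>\<rho>\<close>, but the
  real factor -1 can.\<close>

lemma complexify_hermitian:
  assumes rep: "su3_rep N \<rho>" and A: "\<i> \<cdot>\<^sub>m A \<in> su3"
  shows "complexify \<rho> A = - \<i> \<cdot>\<^sub>m \<rho> (\<i> \<cdot>\<^sub>m A)"
proof -
  have carr: "A \<in> carrier_mat 3 3" 
    using carrier_matD[OF su3_carrier[OF A]] by (intro carrier_matI) simp_all
  have adj: "mat_adjoint (\<i> \<cdot>\<^sub>m A) = - (\<i> \<cdot>\<^sub>m A)" using A by (simp add: su3_def)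
  have herm: "mat_adjoint A = A"
  proof (rule eq_matI)
    fix i j assume "i < dim_row A" "j < dim_col A"
    then have ij: "i < 3" "j < 3" using carr by auto
    have "\<i> * cnj (A $$ (j, i)) = \<i> * A $$ (i, j)"
      using arg_cong[OF adj, of "\<lambda>M. M $$ (i, j)"] ij carr by (simp add: mat_adjoint_index)
    then show "mat_adjoint A $$ (i, j) = A $$ (i, j)" using ij carr by (simp add: mat_adjoint_index)
  qed (use mat_adjoint_carrier[OF carr] carr in auto)
  have 1: "(1 / 2) \<cdot>\<^sub>m (A - mat_adjoint A) = 0\<^sub>m 3 3"
    using carr unfolding herm by (intro eq_matI) auto
  have 2: "(- \<i> / 2) \<cdot>\<^sub>m (A + mat_adjoint A) = complex_of_real (- 1) \<cdot>\<^sub>m (\<i> \<cdot>\<^sub>m A)"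
    using carr unfolding herm by (intro eq_matI) auto
  have 3: "\<rho> (complex_of_real (- 1) \<cdot>\<^sub>m (\<i> \<cdot>\<^sub>m A)) = complex_of_real (- 1) \<cdot>\<^sub>m \<rho> (\<i> \<cdot>\<^sub>m A)"
    and "\<rho> (\<i> \<cdot>\<^sub>m A) \<in> carrier_mat N N"
    using su3_repD(1,3)[OF rep A] by blast+
  then show ?thesis
    unfolding complexify_def 1 2 3 su3_rep_zero[OF rep] by (intro eq_matI) auto
qed

text \<open>Since \<open>diag(1, 1, -2) = diag(1, -1, 0) + 2 diag(0, 1, -1)\<close>, the eigenvalue
  is read off from the two Dynkin labels.\<close>

lemma highest_weight_hypercharge:
  assumes rep: "su3_rep N \<rho>" and v: "highest_weight_vector N \<rho> p q v"
  shows "\<rho> hypercharge *\<^sub>v v = (\<i> * of_int (p + 2 * q)) \<cdot>\<^sub>v v"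
proof -
  let ?h1 = "unit_mat3 0 0 - unit_mat3 1 1" and ?h2 = "unit_mat3 1 1 - unit_mat3 2 2"
  have vc: "v \<in> carrier_vec N" using v by (simp add: highest_weight_vector_def)
  have h: "\<i> \<cdot>\<^sub>m ?h1 \<in> su3" "\<i> \<cdot>\<^sub>m ?h2 \<in> su3"
    by (auto simp: su3_def unit_mat3_def mat_adjoint_def mat_of_rows_def eval_nat_numeral
        intro!: eq_matI)
  have h2: "complex_of_real 2 \<cdot>\<^sub>m (\<i> \<cdot>\<^sub>m ?h2) \<in> su3"
    by (auto simp: su3_def unit_mat3_def mat_adjoint_def mat_of_rows_def eval_nat_numeral
        intro!: eq_matI)
  have eq: "hypercharge = \<i> \<cdot>\<^sub>m ?h1 + complex_of_real 2 \<cdot>\<^sub>m (\<i> \<cdot>\<^sub>m ?h2)"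
    by (rule eq_matI) (auto simp: hypercharge_def hypercharge_eigenvalue_def unit_mat3_def)
  have rho: "\<rho> hypercharge = \<rho> (\<i> \<cdot>\<^sub>m ?h1) + complex_of_real 2 \<cdot>\<^sub>m \<rho> (\<i> \<cdot>\<^sub>m ?h2)"
  proof -
    have "\<rho> hypercharge = \<rho> (\<i> \<cdot>\<^sub>m ?h1) + \<rho> (complex_of_real 2 \<cdot>\<^sub>m (\<i> \<cdot>\<^sub>m ?h2))"
      using su3_repD(2)[OF rep h(1) h2] eq by simp
    also have "\<rho> (complex_of_real 2 \<cdot>\<^sub>m (\<i> \<cdot>\<^sub>m ?h2)) = complex_of_real 2 \<cdot>\<^sub>m \<rho> (\<i> \<cdot>\<^sub>m ?h2)"
      by (rule su3_repD(3)[OF rep h(2)])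
    finally show ?thesis .
  qed
  have carr: "\<rho> (\<i> \<cdot>\<^sub>m ?h1) \<in> carrier_mat N N" "\<rho> (\<i> \<cdot>\<^sub>m ?h2) \<in> carrier_mat N N"
    using su3_repD(1)[OF rep h(1)] su3_repD(1)[OF rep h(2)] .
  have key: "F *\<^sub>v v = (\<i> * c) \<cdot>\<^sub>v v" if "F \<in> carrier_mat N N" "(- \<i> \<cdot>\<^sub>m F) *\<^sub>v v = c \<cdot>\<^sub>v v" for F c
  proof -
    have "(- \<i>) \<cdot>\<^sub>v (F *\<^sub>v v) = c \<cdot>\<^sub>v v"
      using that vc by (simp add: smult_mat_mult_vec[of _ N N])
    from arg_cong[OF this, of "\<lambda>w. \<i> \<cdot>\<^sub>v w"] show ?thesis
      by (simp add: smult_smult_assoc)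
  qed
  have ev: "complexify \<rho> ?h1 *\<^sub>v v = of_int p \<cdot>\<^sub>v v" "complexify \<rho> ?h2 *\<^sub>v v = of_int q \<cdot>\<^sub>v v"
    using v unfolding highest_weight_vector_def by blast+
  have 1: "\<rho> (\<i> \<cdot>\<^sub>m ?h1) *\<^sub>v v = (\<i> * of_int p) \<cdot>\<^sub>v v" "\<rho> (\<i> \<cdot>\<^sub>m ?h2) *\<^sub>v v = (\<i> * of_int q) \<cdot>\<^sub>v v"
    using key[OF carr(1) ev(1)[unfolded complexify_hermitian[OF rep h(1)]]]
      key[OF carr(2) ev(2)[unfolded complexify_hermitian[OF rep h(2)]]] .
  have "\<rho> hypercharge *\<^sub>v v = \<rho> (\<i> \<cdot>\<^sub>m ?h1) *\<^sub>v v + 2 \<cdot>\<^sub>v (\<rho> (\<i> \<cdot>\<^sub>m ?h2) *\<^sub>v v)"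
    unfolding rho using carr vc
    by (simp add: add_mult_distrib_mat_vec[of _ N N] smult_mat_mult_vec[of _ N N])
  also have "\<dots> = (\<i> * of_int (p + 2 * q)) \<cdot>\<^sub>v v"
    unfolding 1 using vc by (intro eq_vecI) (auto simp: algebra_simps)
  finally show ?thesis .
qed

text \<open>The sum of eigenspaces is invariant and contains the highest weight vector, so
  irreducibility makes it the whole space.\<close>

lemma irrep_eigen_span:
  assumes "is_irrep p q N \<rho>"
  shows "\<rho> hypercharge \<in> carrier_mat N N"
    and "eigen_span N (\<rho> hypercharge) (triality_class (p + 2 * q)) = carrier_vec N"
proof -
  let ?W = "eigen_span N (\<rho> hypercharge) (triality_class (p + 2 * q))"
  obtain v where irr: "su3_irreducible N \<rho>" and v: "highest_weight_vector N \<rho> (p - 1) (q - 1) v"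
    using assms by (auto simp: is_irrep_def)
  then have rep: "su3_rep N \<rho>" by (simp add: su3_irreducible_def)
  show U: "\<rho> hypercharge \<in> carrier_mat N N"
    using rep hypercharge_su3 by (auto simp: su3_rep_def)
  \<comment> \<open>The labels are shifted by one; this changes the eigenvalue by
    \<open>3 \<i>\<close>, which the class ignores.\<close>
  have "p - 1 + 2 * (q - 1) = p + 2 * q + 3 * (- 1)" by simp
  then have "\<i> * of_int (p - 1 + 2 * (q - 1)) \<in> triality_class (p + 2 * q)"
    unfolding triality_class_def by (metis (mono_tags, lifting) mem_Collect_eq)
  then have "v \<in> ?W"
    using v highest_weight_hypercharge[OF rep v]
    by (intro eigenvector_in_eigen_span) (auto simp: highest_weight_vector_def)
  moreover have "v \<noteq> 0\<^sub>v N" using v by (simp add: highest_weight_vector_def)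
  moreover have "?W = {0\<^sub>v N} \<or> ?W = carrier_vec N"
    using irr eigen_span_subspace[OF U] su3_rep_eigen_span_invariant[OF rep]
    unfolding su3_irreducible_def by blast
  ultimately show "?W = carrier_vec N" by auto
qed

section \<open>Products of vectors and the spectrum of a tensor product\<close>

lemma mod_div_less:
  assumes "k < (N::nat) * N'" shows "k div N' < N" "k mod N' < N'"
proof -
  have "N' > 0" using assms by (cases N') auto
  then show "k div N' < N" "k mod N' < N'"
    using assms by (auto simp: less_mult_imp_div_less)
qed

lemma sum_div_mod:
  fixes f :: "nat \<Rightarrow> nat \<Rightarrow> 'a :: comm_monoid_add"
  shows "(\<Sum>k<N * N'. f (k div N') (k mod N')) = (\<Sum>i<N. \<Sum>j<N'. f i j)"
proof -
  have "(\<Sum>i<N. \<Sum>j<N'. f i j) = (\<Sum>(i, j)\<in>{..<N} \<times> {..<N'}. f i j)"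
    by (simp add: sum.cartesian_product)
  also have "\<dots> = (\<Sum>k<N * N'. f (k div N') (k mod N'))"
  proof (rule sum.reindex_bij_witness[where i = "\<lambda>k. (k div N', k mod N')" and j = "\<lambda>(i, j). i * N' + j"])
    fix p assume "p \<in> {..<N} \<times> {..<N'}"
    then obtain i j where p: "p = (i, j)" "i < N" "j < N'" by auto
    have "i * N' + j < i * N' + N'" using p by simp
    also have "\<dots> = Suc i * N'" by simp
    also have "\<dots> \<le> N * N'" using p by (intro mult_right_mono) auto
    finally show "(case p of (i, j) \<Rightarrow> i * N' + j) \<in> {..<N * N'}" using p by simp
  qed (auto simp: mod_div_less)
  finally show ?thesis by simp
qed

definition kronecker_vec :: "complex vec \<Rightarrow> complex vec \<Rightarrow> complex vec" where
  "kronecker_vec v w = vec (dim_vec v * dim_vec w) (\<lambda>k. v $ (k div dim_vec w) * w $ (k mod dim_vec w))"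

lemma kronecker_vec_carrier [simp]:
  "v \<in> carrier_vec N \<Longrightarrow> w \<in> carrier_vec N' \<Longrightarrow> kronecker_vec v w \<in> carrier_vec (N * N')"
  by (auto simp: kronecker_vec_def)

text \<open>Splitting the summation index by \<open>div\<close> and \<open>mod\<close> turns the sum
  into a product of two sums.\<close>

lemma kronecker_mult_vec:
  assumes "A \<in> carrier_mat N N" "B \<in> carrier_mat N' N'" "v \<in> carrier_vec N" "w \<in> carrier_vec N'"
  shows "kronecker A B *\<^sub>v kronecker_vec v w = kronecker_vec (A *\<^sub>v v) (B *\<^sub>v w)"
proof (rule eq_vecI)
  fix r assume "r < dim_vec (kronecker_vec (A *\<^sub>v v) (B *\<^sub>v w))"
  then have r: "r < N * N'" using assms by (simp add: kronecker_vec_def)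
  note r' = mod_div_less[OF r]
  have "(kronecker A B *\<^sub>v kronecker_vec v w) $ r =
    (\<Sum>k<N * N'. A $$ (r div N', k div N') * B $$ (r mod N', k mod N') * (v $ (k div N') * w $ (k mod N')))"
    using assms r by (auto simp: kronecker_def kronecker_vec_def scalar_prod_def lessThan_atLeast0
        intro!: sum.cong)
  also have "\<dots> = (\<Sum>i<N. \<Sum>j<N'. A $$ (r div N', i) * B $$ (r mod N', j) * (v $ i * w $ j))"
    by (rule sum_div_mod)
  also have "\<dots> = (\<Sum>i<N. A $$ (r div N', i) * v $ i) * (\<Sum>j<N'. B $$ (r mod N', j) * w $ j)"
    by (simp add: sum_product algebra_simps)
  also have "\<dots> = kronecker_vec (A *\<^sub>v v) (B *\<^sub>v w) $ r"
    using assms r r' by (simp add: kronecker_vec_def scalar_prod_def lessThan_atLeast0)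
  finally show "(kronecker A B *\<^sub>v kronecker_vec v w) $ r = kronecker_vec (A *\<^sub>v v) (B *\<^sub>v w) $ r" .
qed (use assms in \<open>auto simp: kronecker_def kronecker_vec_def\<close>)

lemma kronecker_vec_smult_left:
  "v \<in> carrier_vec N \<Longrightarrow> kronecker_vec (c \<cdot>\<^sub>v v) w = c \<cdot>\<^sub>v kronecker_vec v w"
  by (intro eq_vecI) (auto simp: kronecker_vec_def mod_div_less)

lemma kronecker_vec_smult_right:
  "w \<in> carrier_vec N' \<Longrightarrow> kronecker_vec v (c \<cdot>\<^sub>v w) = c \<cdot>\<^sub>v kronecker_vec v w"
  by (intro eq_vecI) (auto simp: kronecker_vec_def mod_div_less)

lemma kronecker_vec_add_left:
  "v \<in> carrier_vec N \<Longrightarrow> v' \<in> carrier_vec N \<Longrightarrow>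
    kronecker_vec (v + v') w = kronecker_vec v w + kronecker_vec v' w"
  by (intro eq_vecI) (auto simp: kronecker_vec_def mod_div_less algebra_simps)

lemma kronecker_vec_add_right:
  "w \<in> carrier_vec N' \<Longrightarrow> w' \<in> carrier_vec N' \<Longrightarrow>
    kronecker_vec v (w + w') = kronecker_vec v w + kronecker_vec v w'"
  by (intro eq_vecI) (auto simp: kronecker_vec_def mod_div_less algebra_simps)

text \<open>Every unit vector is a product, so a functional vanishing on all products is
  zero.\<close>

lemma kronecker_vec_unit:
  assumes "k < N * N'"
  shows "kronecker_vec (unit_vec N (k div N')) (unit_vec N' (k mod N')) = unit_vec (N * N') k"
proof (rule eq_vecI)
  fix r assume "r < dim_vec (unit_vec (N * N') k :: complex vec)"
  then have r: "r < N * N'" by simp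
  have "r = k" if "r div N' = k div N'" "r mod N' = k mod N'"
    using that by (metis div_mult_mod_eq)
  then show "kronecker_vec (unit_vec N (k div N')) (unit_vec N' (k mod N')) $ r = unit_vec (N * N') k $ r"
    using assms r mod_div_less[OF assms] mod_div_less[OF r] by (auto simp: kronecker_vec_def)
qed (simp add: kronecker_vec_def)

text \<open>A left eigenvector of \<open>U \<otimes> 1 + 1 \<otimes> U'\<close> whose eigenvalue is not a sum of eigenvalues of \<open>U\<close>
  and \<open>U'\<close> would annihilate all products of eigenvectors.\<close>

lemma kronecker_sum_eigenvalue:
  assumes U: "U \<in> carrier_mat N N" "eigen_span N U K = carrier_vec N"
    and U': "U' \<in> carrier_mat N' N'" "eigen_span N' U' K' = carrier_vec N'"
    and ev: "eigenvalue (kronecker U (1\<^sub>m N') + kronecker (1\<^sub>m N) U') \<gamma>"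
  shows "\<exists>\<alpha>\<in>K. \<exists>\<beta>\<in>K'. \<gamma> = \<alpha> + \<beta>"
proof (rule ccontr)
  assume neg: "\<not> (\<exists>\<alpha>\<in>K. \<exists>\<beta>\<in>K'. \<gamma> = \<alpha> + \<beta>)"
  let ?T = "kronecker U (1\<^sub>m N') + kronecker (1\<^sub>m N) U'"
  have T: "?T \<in> carrier_mat (N * N') (N * N')"
    and T12: "kronecker U (1\<^sub>m N') \<in> carrier_mat (N * N') (N * N')"
      "kronecker (1\<^sub>m N) U' \<in> carrier_mat (N * N') (N * N')"
    using U(1) U'(1) by (auto simp: kronecker_def)
  \<comment> \<open>A matrix and its transpose have the same characteristic polynomial.\<close>
  have "eigenvalue (transpose_mat ?T) \<gamma>"
    using ev T by (simp add: eigenvalue_root_char_poly[of _ "N * N'"])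
  then obtain y where y: "y \<in> carrier_vec (N * N')" "y \<noteq> 0\<^sub>v (N * N')" "transpose_mat ?T *\<^sub>v y = \<gamma> \<cdot>\<^sub>v y"
    using T by (auto simp: eigenvalue_def eigenvector_def)
  have eig: "y \<bullet> kronecker_vec u u' = 0"
    if u: "u \<in> carrier_vec N" "\<alpha> \<in> K" "U *\<^sub>v u = \<alpha> \<cdot>\<^sub>v u"
      and u': "u' \<in> carrier_vec N'" "\<beta> \<in> K'" "U' *\<^sub>v u' = \<beta> \<cdot>\<^sub>v u'" for u u' \<alpha> \<beta>
  proof -
    let ?z = "kronecker_vec u u'"
    have z: "?z \<in> carrier_vec (N * N')" using u(1) u'(1) by simp
    have "?T *\<^sub>v ?z = \<alpha> \<cdot>\<^sub>v ?z + \<beta> \<cdot>\<^sub>v ?z"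
      using T12 U(1) U'(1) u u' z
      by (simp add: add_mult_distrib_mat_vec[of _ "N * N'" "N * N'"] kronecker_mult_vec[of _ N _ N']
          kronecker_vec_smult_left[of _ N] kronecker_vec_smult_right[of _ N'])
    then have "y \<bullet> (?T *\<^sub>v ?z) = (\<alpha> + \<beta>) * (y \<bullet> ?z)"
      using y(1) z by (simp add: scalar_prod_add_distrib[of _ "N * N'"] algebra_simps)
    moreover have "y \<bullet> (?T *\<^sub>v ?z) = (transpose_mat ?T *\<^sub>v y) \<bullet> ?z"
      using transpose_vec_mult_scalar[OF T z y(1)] by simp
    then have "y \<bullet> (?T *\<^sub>v ?z) = \<gamma> * (y \<bullet> ?z)"
      unfolding y(3) using y(1) z by simp
    moreover have "\<gamma> \<noteq> \<alpha> + \<beta>" using neg u(2) u'(2) by blast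
    ultimately show ?thesis by simp
  qed
  \<comment> \<open>Bilinearity is used one factor at a time: first sums on the left, then sums on
    the right.\<close>
  have half: "y \<bullet> kronecker_vec w u' = 0"
    if w: "w \<in> eigen_span N U K"
      and u': "u' \<in> carrier_vec N'" "\<beta> \<in> K'" "U' *\<^sub>v u' = \<beta> \<cdot>\<^sub>v u'" for w u' \<beta>
    using w
  proof (induction rule: eigen_span.induct)
    case zero
    have "kronecker_vec (0\<^sub>v N) u' = 0\<^sub>v (N * N')"
      using u'(1) by (intro eq_vecI) (auto simp: kronecker_vec_def mod_div_less)
    then show ?case using y(1) by simp
  next
    case (add w u \<mu>)
    then show ?case
      using u' y(1) eigen_span_carrier[OF add(1)] eig[OF add(2-4) u']
      by (simp add: kronecker_vec_add_left[of _ N] scalar_prod_add_distrib[of _ "N * N'"])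
  qed
  have full: "y \<bullet> kronecker_vec w w' = 0"
    if w: "w \<in> eigen_span N U K" and w': "w' \<in> eigen_span N' U' K'" for w w'
    using w'
  proof (induction rule: eigen_span.induct)
    case zero
    have "kronecker_vec w (0\<^sub>v N') = 0\<^sub>v (N * N')"
      using eigen_span_carrier[OF w] by (intro eq_vecI) (auto simp: kronecker_vec_def mod_div_less)
    then show ?case using y(1) by simp
  next
    case (add w' u' \<beta>)
    then show ?case
      using y(1) eigen_span_carrier[OF w] eigen_span_carrier[OF add(1)] half[OF w add(2-4)]
      by (simp add: kronecker_vec_add_right[of _ N'] scalar_prod_add_distrib[of _ "N * N'"])
  qed
  have "y = 0\<^sub>v (N * N')"
  proof (rule eq_vecI)
    fix k assume "k < dim_vec (0\<^sub>v (N * N') :: complex vec)"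
    then have k: "k < N * N'" by simp
    have "y \<bullet> unit_vec (N * N') k = 0"
      unfolding kronecker_vec_unit[OF k, symmetric]
      by (rule full) (use U(2) U'(2) in auto)
    then show "y $ k = 0\<^sub>v (N * N') $ k"
      using y(1) k by (simp add: scalar_prod_right_unit)
  qed (use y(1) in auto)
  with y(2) show False ..
qed

section \<open>Intertwiners and divisibility by 3\<close>

text \<open>\<open>T\<close> sends an eigenvector of \<open>U\<close> to zero or to an eigenvector
  of \<open>S\<close> with the same eigenvalue. Without a common eigenvalue it would kill a spanning
  set.\<close>

lemma intertwiner_eigenvalue:
  assumes U: "U \<in> carrier_mat n n" "eigen_span n U K = carrier_vec n"
    and T: "T \<in> carrier_mat r n" "T \<noteq> 0\<^sub>m r n" and S: "S \<in> carrier_mat r r"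
    and comm: "T * U = S * T"
  shows "\<exists>\<gamma>\<in>K. eigenvalue S \<gamma>"
proof (rule ccontr)
  assume neg: "\<not> (\<exists>\<gamma>\<in>K. eigenvalue S \<gamma>)"
  have kill: "T *\<^sub>v w = 0\<^sub>v r" if "w \<in> eigen_span n U K" for w
    using that
  proof (induction rule: eigen_span.induct)
    case zero
    show ?case using T(1) by auto
  next
    case (add w u \<gamma>)
    have "S *\<^sub>v (T *\<^sub>v u) = T *\<^sub>v (U *\<^sub>v u)"
      using S T(1) U(1) add(2) comm by (metis assoc_mult_mat_vec)
    also have "\<dots> = \<gamma> \<cdot>\<^sub>v (T *\<^sub>v u)"
      using T(1) add(2,4) by (simp add: mult_mat_vec)
    finally have ev: "S *\<^sub>v (T *\<^sub>v u) = \<gamma> \<cdot>\<^sub>v (T *\<^sub>v u)" .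
    moreover have "T *\<^sub>v u \<in> carrier_vec r" using T(1) add(2) by auto
    ultimately have "T *\<^sub>v u = 0\<^sub>v r"
      using neg add(3) S unfolding eigenvalue_def eigenvector_def by auto
    then show ?case
      using add.IH T(1) add(2) eigen_span_carrier[OF add(1)]
      by (simp add: mult_add_distrib_mat_vec[of _ r n])
  qed
  have "T = 0\<^sub>m r n"
  proof (rule eq_matI)
    fix i j assume "i < dim_row (0\<^sub>m r n :: complex mat)" "j < dim_col (0\<^sub>m r n :: complex mat)"
    then have ij: "i < r" "j < n" by auto
    have "T *\<^sub>v unit_vec n j = 0\<^sub>v r" by (rule kill) (simp add: U(2))
    then have "(T *\<^sub>v unit_vec n j) $ i = 0" using ij by simp
    then show "T $$ (i, j) = 0\<^sub>m r n $$ (i, j)"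
      using T(1) ij by (simp add: scalar_prod_right_unit)
  qed (use T(1) in auto)
  with T(2) show False ..
qed

text \<open>Otherwise the space of intertwiners is the zero space, generated by the empty set and so
  of dimension 0.\<close>

lemma nonzero_intertwiner:
  assumes "multiplicity_in K \<tau> N \<rho> > 0" and rho: "\<And>A. A \<in> su3 \<Longrightarrow> \<rho> A \<in> carrier_mat N N"
    and tau: "\<And>A. A \<in> su3 \<Longrightarrow> \<tau> A \<in> carrier_mat K K"
  shows "\<exists>T\<in>intertwiners K \<tau> N \<rho>. T \<noteq> 0\<^sub>m N K"
proof (rule ccontr)
  assume neg: "\<not> ?thesis"
  have "0\<^sub>m N K \<in> intertwiners K \<tau> N \<rho>"
    using rho tau by (auto simp: intertwiners_def) (metis left_mult_zero_mat right_mult_zero_mat)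
  with neg have I: "intertwiners K \<tau> N \<rho> = {0\<^sub>m N K}" by blast
  have "VectorSpace.subspace class_ring {0\<^sub>m N K} (module_mat TYPE(complex) N K)"
    using matrix_vs[where 'a=complex] vectorspace.axioms(1)[OF matrix_vs[where 'a=complex]]
    unfolding VectorSpace.subspace_def LinearCombinations.submodule_def module_mat_simps
    by simp
  then have "vectorspace class_ring ((module_mat TYPE(complex) N K)\<lparr>carrier := {0\<^sub>m N K}\<rparr>)"
    by (rule vectorspace.subspace_is_vs[OF matrix_vs])
  then interpret W: vectorspace class_ring "(module_mat TYPE(complex) N K)\<lparr>carrier := {0\<^sub>m N K}\<rparr>" .
  have "W.dim \<le> card ({} :: complex mat set)"
  proof (rule W.gen_ge_dim)
    show "W.gen_set {}"
      by (auto simp: W.span_def W.lincomb_def module_mat_simps)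
  qed auto
  then show False using assms(1) by (simp add: multiplicity_in_def I)
qed

text \<open>A non-zero intertwiner yields an eigenvalue that lies in the class of
  \<open>[m1'', m2'']\<close> and is a sum of elements of the classes of the two factors.\<close>

lemma tensor_multiplicity_triality:
  assumes "tensor_multiplicity (m1, m2, m1', m2', m1'', m2'') d" "d > 0"
  shows "\<exists>s. (m1 + 2 * m2) + (m1' + 2 * m2') - (m1'' + 2 * m2'') = 3 * s"
proof -
  obtain N \<rho> N' \<rho>' N'' \<rho>'' where irr: "is_irrep m1 m2 N \<rho>" "is_irrep m1' m2' N' \<rho>'"
      "is_irrep m1'' m2'' N'' \<rho>''"
    and d: "d = multiplicity_in N'' \<rho>'' (N * N') (tensor_rep N \<rho> N' \<rho>')"
    using assms(1) by auto
  have rep: "su3_rep N \<rho>" "su3_rep N' \<rho>'" "su3_rep N'' \<rho>''"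
    using irr by (auto simp: is_irrep_def su3_irreducible_def)
  have S: "tensor_rep N \<rho> N' \<rho>' A \<in> carrier_mat (N * N') (N * N')" if "A \<in> su3" for A
    using su3_repD(1)[OF rep(1) that] su3_repD(1)[OF rep(2) that]
    by (auto simp: tensor_rep_def kronecker_def)
  have "multiplicity_in N'' \<rho>'' (N * N') (tensor_rep N \<rho> N' \<rho>') > 0"
    using assms(2) d by simp
  from nonzero_intertwiner[OF this S su3_repD(1)[OF rep(3)]]
  obtain T where T: "T \<in> intertwiners N'' \<rho>'' (N * N') (tensor_rep N \<rho> N' \<rho>')" "T \<noteq> 0\<^sub>m (N * N') N''"
    by blast
  have "\<exists>\<gamma>\<in>triality_class (m1'' + 2 * m2''). eigenvalue (tensor_rep N \<rho> N' \<rho>' hypercharge) \<gamma>"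
    using T S[OF hypercharge_su3] hypercharge_su3
    by (intro intertwiner_eigenvalue[OF irrep_eigen_span[OF irr(3)], of T]) (auto simp: intertwiners_def)
  then obtain \<gamma> where \<gamma>: "\<gamma> \<in> triality_class (m1'' + 2 * m2'')"
    and "eigenvalue (tensor_rep N \<rho> N' \<rho>' hypercharge) \<gamma>" by blast
  then obtain \<alpha> \<beta> where "\<alpha> \<in> triality_class (m1 + 2 * m2)" "\<beta> \<in> triality_class (m1' + 2 * m2')"
    and sum: "\<gamma> = \<alpha> + \<beta>"
    using kronecker_sum_eigenvalue[OF irrep_eigen_span[OF irr(1)] irrep_eigen_span[OF irr(2)]]
    unfolding tensor_rep_def by blast
  then obtain s s' s'' where "\<alpha> = \<i> * of_int (m1 + 2 * m2 + 3 * s)"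
    "\<beta> = \<i> * of_int (m1' + 2 * m2' + 3 * s')" "\<gamma> = \<i> * of_int (m1'' + 2 * m2'' + 3 * s'')"
    using \<gamma> by (auto simp: triality_class_def)
  with sum have "\<i> * of_int (m1'' + 2 * m2'' + 3 * s'') =
     \<i> * of_int ((m1 + 2 * m2 + 3 * s) + (m1' + 2 * m2' + 3 * s'))"
    by (simp add: distrib_left)
  then have "m1'' + 2 * m2'' + 3 * s'' = (m1 + 2 * m2 + 3 * s) + (m1' + 2 * m2' + 3 * s')"
    unfolding mult_cancel_left of_int_eq_iff by simp
  then have "(m1 + 2 * m2) + (m1' + 2 * m2') - (m1'' + 2 * m2'') = 3 * (s'' - s - s')" by simp
  then show ?thesis ..
qed

section \<open>Magic squares and arrangements\<close>

text \<open>With rows, columns and the triples \<open>u = (a, b, c)\<close>, \<open>v = (p, q, r)\<close> indexed by \<open>0, 1, 2\<close>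
  modulo 3, the entry at \<open>(i, j)\<close> is \<open>u (i + j) - v (j - i)\<close>: the indices of \<open>u\<close> stand for the odd
  and those of \<open>v\<close> for the even permutations through \<open>(i, j)\<close>. An odd permutation of the rows
  interchanges the two kinds and hence replaces \<open>(u, v)\<close> by \<open>(- v, - u)\<close>, up to order.\<close>

definition magic_square :: "real \<Rightarrow> real \<Rightarrow> real \<Rightarrow> real \<Rightarrow> real \<Rightarrow> real \<Rightarrow> real mat" where
  "magic_square a b c p q r = mat_of_rows_list 3
     [[a - p, b - q, c - r],
      [b - r, c - p, a - q],
      [c - q, a - r, b - p]]"

lemma magic_square_carrier [simp]: "magic_square a b c p q r \<in> carrier_mat 3 3"
  by (rule carrier_matI) (simp_all add: magic_square_def mat_of_rows_list_def)

lemma eq_mat_3I: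
  assumes "A \<in> carrier_mat 3 3" "B \<in> carrier_mat 3 3"
    and "A $$ (0, 0) = B $$ (0, 0)" "A $$ (0, 1) = B $$ (0, 1)" "A $$ (0, 2) = B $$ (0, 2)"
    and "A $$ (1, 0) = B $$ (1, 0)" "A $$ (1, 1) = B $$ (1, 1)" "A $$ (1, 2) = B $$ (1, 2)"
    and "A $$ (2, 0) = B $$ (2, 0)" "A $$ (2, 1) = B $$ (2, 1)" "A $$ (2, 2) = B $$ (2, 2)"
  shows "A = B"
proof (rule eq_matI)
  fix i j assume "i < dim_row B" "j < dim_col B"
  then have "i = 0 \<or> i = 1 \<or> i = 2" "j = 0 \<or> j = 1 \<or> j = 2" using assms(2) by auto
  then show "A $$ (i, j) = B $$ (i, j)" using assms(3-) by auto
qed (use assms in auto)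

lemma magic_square_index:
  "magic_square a b c p q r $$ (0, 0) = a - p"
  "magic_square a b c p q r $$ (0, 1) = b - q"
  "magic_square a b c p q r $$ (0, 2) = c - r"
  "magic_square a b c p q r $$ (1, 0) = b - r"
  "magic_square a b c p q r $$ (1, 1) = c - p"
  "magic_square a b c p q r $$ (1, 2) = a - q"
  "magic_square a b c p q r $$ (2, 0) = c - q"
  "magic_square a b c p q r $$ (2, 1) = a - r"
  "magic_square a b c p q r $$ (2, 2) = b - p"
  "magic_square a b c p q r $$ (Suc 0, 0) = b - r"
  "magic_square a b c p q r $$ (Suc 0, Suc 0) = c - p"
  "magic_square a b c p q r $$ (Suc 0, 2) = a - q"
  "magic_square a b c p q r $$ (0, Suc 0) = b - q"
  "magic_square a b c p q r $$ (2, Suc 0) = a - r"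
  by (simp_all add: magic_square_def mat_of_rows_list_def)

text \<open>Exchanging \<open>i\<close> and \<open>j\<close> fixes \<open>i + j\<close> and negates
  \<open>j - i\<close> modulo 3, so only the indices 1 and 2 of \<open>v\<close> are
  exchanged.\<close>

lemma transpose_magic_square:
  "transpose_mat (magic_square a b c p q r) = magic_square a b c p r q"
  by (rule eq_mat_3I) (simp_all add: magic_square_index magic_square_carrier[THEN carrier_matD(1)]
      magic_square_carrier[THEN carrier_matD(2)])

section \<open>Row exchanges of a square\<close>

definition permute_rows :: "(nat \<Rightarrow> nat) \<Rightarrow> real mat \<Rightarrow> real mat" where
  "permute_rows \<sigma> M = mat 3 3 (\<lambda>(i, j). M $$ (\<sigma> i, j))"

text \<open>Each exchange is \<open>i \<mapsto> s - i\<close> modulo 3, with \<open>s\<close> equal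
  to 1, 2, 0 in turn. The new triples are \<open>- v (k - s)\<close> and \<open>- u (k + s)\<close>
  at index \<open>k\<close>.\<close>

lemma swap_rows_magic_square:
  "permute_rows (Transposition.transpose 0 1) (magic_square a b c p q r) =
     magic_square (- r) (- p) (- q) (- b) (- c) (- a)"
  "permute_rows (Transposition.transpose 0 2) (magic_square a b c p q r) =
     magic_square (- q) (- r) (- p) (- c) (- a) (- b)"
  "permute_rows (Transposition.transpose 1 2) (magic_square a b c p q r) =
     magic_square (- p) (- q) (- r) (- a) (- b) (- c)"
  by (rule eq_mat_3I; simp add: permute_rows_def magic_square_index Transposition.transpose_def)+

lemma magic_square_shift:
  "magic_square a b c (p - t) (q - t) (r - t) = magic_square (a + t) (b + t) (c + t) p q r"
  by (rule eq_mat_3I) (simp_all add: magic_square_index)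

text \<open>The two squares of an arrangement differ by the constant \<open>\<bar>\<ell> - n\<bar>\<close>; the triples are those of the
  square with the smaller entries.\<close>

definition represents :: "arrangement \<Rightarrow> real multiset \<times> real multiset \<Rightarrow> real \<Rightarrow> bool" where
  "represents A UV \<delta> \<longleftrightarrow> \<delta> \<ge> 0 \<and> (\<exists>a b c p q r. UV = ({#a, b, c#}, {#p, q, r#}) \<and>
     (A = (magic_square a b c p q r, magic_square (a + \<delta>) (b + \<delta>) (c + \<delta>) p q r) \<or>
      A = (magic_square (a + \<delta>) (b + \<delta>) (c + \<delta>) p q r, magic_square a b c p q r)))"

lemma representsI:
  assumes "\<delta> \<ge> 0"
    and "A = (magic_square a b c p q r, magic_square (a + \<delta>) (b + \<delta>) (c + \<delta>) p q r) \<or>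
      A = (magic_square (a + \<delta>) (b + \<delta>) (c + \<delta>) p q r, magic_square a b c p q r)"
  shows "represents A ({#a, b, c#}, {#p, q, r#}) \<delta>"
  using assms unfolding represents_def by blast

section \<open>The operations on represented arrangements\<close>

definition flip_sign :: "int \<Rightarrow> real multiset \<times> real multiset \<Rightarrow> real multiset \<times> real multiset" where
  "flip_sign s UV = (if s = 1 then UV else (image_mset uminus (snd UV), image_mset uminus (fst UV)))"

lemma flip_sign_mult:
  "s \<in> {1, - 1} \<Longrightarrow> t \<in> {1, - 1} \<Longrightarrow> flip_sign (s * t) UV = flip_sign t (flip_sign s UV)"
  by (auto simp: flip_sign_def multiset.map_comp comp_def)

lemma sign_in: "sign \<sigma> \<in> {1, - 1 :: int}"
  by (simp add: sign_def)

lemma represents_swap_rows: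
  assumes "represents (L, R) UV \<delta>" "x \<in> {0..<3}" "y \<in> {0..<3}" "x \<noteq> y"
  defines "\<tau> \<equiv> Transposition.transpose x y"
  shows "represents (permute_rows \<tau> L, permute_rows \<tau> R) (flip_sign (- 1) UV) \<delta>"
proof -
  obtain a b c p q r where UV: "UV = ({#a, b, c#}, {#p, q, r#})" and \<delta>: "\<delta> \<ge> 0" and
    LR: "(L, R) = (magic_square a b c p q r, magic_square (a + \<delta>) (b + \<delta>) (c + \<delta>) p q r) \<or>
      (L, R) = (magic_square (a + \<delta>) (b + \<delta>) (c + \<delta>) p q r, magic_square a b c p q r)"
    using assms(1) unfolding represents_def by blast
  \<comment> \<open>Negating and exchanging the triples moves the offset to the second triple with
    opposite sign; \<open>magic_square_shift\<close> returns it to the first. The values 0 and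
    \<open>\<delta>\<close> of \<open>t\<close> give the two squares.\<close>
  have repI: "represents (permute_rows \<tau> L, permute_rows \<tau> R) (flip_sign (- 1) UV) \<delta>"
    if "{#- p, - q, - r#} = {#a', b', c'#}" "{#- a, - b, - c#} = {#p', q', r'#}"
      "\<And>t. permute_rows \<tau> (magic_square (a + t) (b + t) (c + t) p q r)
        = magic_square a' b' c' (p' - t) (q' - t) (r' - t)" for a' b' c' p' q' r'
  proof -
    have fl: "flip_sign (- 1) UV = ({#a', b', c'#}, {#p', q', r'#})"
      using that(1,2) by (simp add: flip_sign_def UV)
    have "permute_rows \<tau> (magic_square a b c p q r) = magic_square a' b' c' p' q' r'"
      using that(3)[of 0] by simp
    moreover have "permute_rows \<tau> (magic_square (a + \<delta>) (b + \<delta>) (c + \<delta>) p q r)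
        = magic_square (a' + \<delta>) (b' + \<delta>) (c' + \<delta>) p' q' r'"
      using that(3)[of \<delta>] magic_square_shift by metis
    ultimately show ?thesis
      using LR unfolding fl by (intro representsI[OF \<delta>]) auto
  qed
  have "\<tau> = Transposition.transpose 0 1 \<or> \<tau> = Transposition.transpose 0 2 \<or> \<tau> = Transposition.transpose 1 2"
  proof -
    have "x = 0 \<or> x = 1 \<or> x = 2" "y = 0 \<or> y = 1 \<or> y = 2" using assms(2,3) by auto
    then show ?thesis
      using assms(4) unfolding \<tau>_def
      by (auto simp: transpose_commute[of "Suc 0" 0] transpose_commute[of 2 "0::nat"]
          transpose_commute[of 2 "Suc 0"])
  qed
  then show ?thesis
  proof (elim disjE)
    assume "\<tau> = Transposition.transpose 0 1"
    then show ?thesis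
      by (intro repI[of "- r" "- p" "- q" "- b" "- c" "- a"])
        (simp_all only: swap_rows_magic_square, simp_all add: add_mset_commute)
  next
    assume "\<tau> = Transposition.transpose 0 2"
    then show ?thesis
      by (intro repI[of "- q" "- r" "- p" "- c" "- a" "- b"])
        (simp_all only: swap_rows_magic_square, simp_all add: add_mset_commute)
  next
    assume "\<tau> = Transposition.transpose 1 2"
    then show ?thesis
      by (intro repI[of "- p" "- q" "- r" "- a" "- b" "- c"])
        (simp_all only: swap_rows_magic_square, simp_all add: add_mset_commute)
  qed
qed

lemma represents_carrier:
  "represents (L, R) UV \<delta> \<Longrightarrow> L \<in> carrier_mat 3 3 \<and> R \<in> carrier_mat 3 3"
  by (auto simp: represents_def)

lemma represents_permute_rows:
  assumes "\<sigma> permutes {0..<3}" "represents (L, R) UV \<delta>"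
  shows "represents (permute_rows \<sigma> L, permute_rows \<sigma> R) (flip_sign (sign \<sigma>) UV) \<delta>"
  using assms(1) finite_atLeastLessThan assms(2)
proof (induction \<sigma> arbitrary: L R UV rule: permutes_induct)
  case id
  have "permute_rows id M = M" if "M \<in> carrier_mat 3 3" for M
    using that by (intro eq_matI) (auto simp: permute_rows_def)
  then show ?case
    using id represents_carrier[OF id] by (simp add: flip_sign_def del: id_apply)
next
  case (swap x y p)
  let ?\<tau> = "Transposition.transpose x y"
  \<comment> \<open>Acting on indices reverses the order: the exchange is performed first and
    \<open>p\<close> afterwards.\<close>
  have comp: "permute_rows (?\<tau> \<circ> p) M = permute_rows p (permute_rows ?\<tau> M)" for M
  proof (rule eq_matI)
    fix i j assume "i < dim_row (permute_rows p (permute_rows ?\<tau> M))"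
      "j < dim_col (permute_rows p (permute_rows ?\<tau> M))"
    then have "i < 3" "j < 3" by (auto simp: permute_rows_def)
    moreover have "p i < 3" using permutes_in_image[OF \<open>p permutes {0..<3}\<close>, of i] \<open>i < 3\<close> by auto
    ultimately show "permute_rows (?\<tau> \<circ> p) M $$ (i, j) = permute_rows p (permute_rows ?\<tau> M) $$ (i, j)"
      by (simp add: permute_rows_def)
  qed (auto simp: permute_rows_def)
  have "permutation p" using \<open>p permutes {0..<3}\<close> permutation_permutes by blast
  then have "sign (?\<tau> \<circ> p) = - 1 * sign p"
    using \<open>x \<noteq> y\<close> by (simp add: sign_compose permutation_swap_id sign_swap_id)
  then have flip: "flip_sign (sign (?\<tau> \<circ> p)) UV = flip_sign (sign p) (flip_sign (- 1) UV)"
    using flip_sign_mult[OF _ sign_in, of "- 1"] by simp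
  then show ?case
    unfolding comp flip
    by (intro swap.IH represents_swap_rows[OF swap.prems \<open>x \<in> {0..<3}\<close> \<open>y \<in> {0..<3}\<close> \<open>x \<noteq> y\<close>])
qed

lemma represents_Transpose:
  assumes "represents (L, R) UV \<delta>"
  shows "represents (transpose_mat L, transpose_mat R) UV \<delta>"
proof -
  obtain a b c p q r where UV: "UV = ({#a, b, c#}, {#p, q, r#})" and \<delta>: "\<delta> \<ge> 0" and
    LR: "(L, R) = (magic_square a b c p q r, magic_square (a + \<delta>) (b + \<delta>) (c + \<delta>) p q r) \<or>
      (L, R) = (magic_square (a + \<delta>) (b + \<delta>) (c + \<delta>) p q r, magic_square a b c p q r)"
    using assms(1) unfolding represents_def by blast
  have "represents (transpose_mat L, transpose_mat R) ({#a, b, c#}, {#p, r, q#}) \<delta>"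
    using LR by (intro representsI[OF \<delta>]) (elim disjE; simp add: transpose_magic_square)
  then show ?thesis by (simp add: UV add_mset_commute)
qed

lemma represents_Exchange: "represents (L, R) UV \<delta> \<Longrightarrow> represents (R, L) UV \<delta>"
  unfolding represents_def by blast

text \<open>Reduces columns to rows; the transpositions contribute no sign.\<close>

lemma permute_cols_eq:
  assumes "M \<in> carrier_mat 3 3" "\<sigma> permutes {0..<3}"
  shows "mat 3 3 (\<lambda>(i, j). M $$ (i, \<sigma> j)) = transpose_mat (permute_rows \<sigma> (transpose_mat M))"
proof (rule eq_matI)
  fix i j assume "i < dim_row (transpose_mat (permute_rows \<sigma> (transpose_mat M)))"
    "j < dim_col (transpose_mat (permute_rows \<sigma> (transpose_mat M)))"
  then have "i < 3" "j < 3" by (auto simp: permute_rows_def)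
  moreover have "\<sigma> j < 3" using permutes_in_image[OF assms(2), of j] \<open>j < 3\<close> by auto
  ultimately show "mat 3 3 (\<lambda>(i, j). M $$ (i, \<sigma> j)) $$ (i, j) =
      transpose_mat (permute_rows \<sigma> (transpose_mat M)) $$ (i, j)"
    using assms(1) by (simp add: permute_rows_def)
qed (auto simp: permute_rows_def)

lemma represents_apply_op:
  assumes "valid_op op" "represents A UV \<delta>"
  shows "represents (apply_op op A) (flip_sign (op_sign op) UV) \<delta>"
proof -
  obtain L R where A: "A = (L, R)" by (cases A)
  note rep = assms(2)[unfolded A] and carr = represents_carrier[OF assms(2)[unfolded A]]
  show ?thesis
  proof (cases op)
    case (Permute_Rows \<sigma>)
    then show ?thesis
      using represents_permute_rows[OF _ rep] assms(1) by (simp add: A permute_rows_def)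
  next
    case (Permute_Cols \<sigma>)
    then have \<sigma>: "\<sigma> permutes {0..<3}" using assms(1) by simp
    show ?thesis
      using represents_Transpose[OF represents_permute_rows[OF \<sigma> represents_Transpose[OF rep]]]
        permute_cols_eq[OF _ \<sigma>] carr by (simp add: A Permute_Cols)
  next
    case Transpose
    then show ?thesis using represents_Transpose[OF rep] by (simp add: A flip_sign_def)
  next
    case Exchange
    then show ?thesis using represents_Exchange[OF rep] by (simp add: A flip_sign_def)
  qed
qed

lemma op_sign_in: "op_sign op \<in> {1, - 1}"
  using sign_in by (cases op) auto

lemma ops_sign_in: "ops_sign ops \<in> {1, - 1}"
proof (induction ops)
  case (Cons op ops)
  then show ?case using op_sign_in[of op] by (auto simp: ops_sign_def)
qed (simp add: ops_sign_def)

lemma represents_apply_ops: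
  assumes "\<forall>op\<in>set ops. valid_op op" "represents A UV \<delta>"
  shows "represents (apply_ops ops A) (flip_sign (ops_sign ops) UV) \<delta>"
  using assms
proof (induction ops arbitrary: A UV)
  case Nil
  then show ?case by (simp add: apply_ops_def ops_sign_def flip_sign_def)
next
  case (Cons op ops)
  have "represents (apply_ops ops (apply_op op A))
     (flip_sign (ops_sign ops) (flip_sign (op_sign op) UV)) \<delta>"
    using Cons.prems by (intro Cons.IH represents_apply_op) auto
  moreover have "ops_sign (op # ops) = op_sign op * ops_sign ops" by (simp add: ops_sign_def)
  ultimately show ?case
    using flip_sign_mult[OF op_sign_in ops_sign_in] by (simp add: apply_ops_def)
qed

section \<open>Recovering the triples from an arrangement\<close>

text \<open>The entries are all nine differences between the two triples, which fix both up to a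
  common translation.\<close>

lemma magic_square_eqD:
  assumes "magic_square a b c p q r = magic_square a' b' c' p' q' r'"
  shows "\<exists>t. a' = a + t \<and> b' = b + t \<and> c' = c + t \<and> p' = p + t \<and> q' = q + t \<and> r' = r + t"
  using arg_cong[OF assms, of "\<lambda>M. M $$ (0, 0)"] arg_cong[OF assms, of "\<lambda>M. M $$ (0, 1)"]
    arg_cong[OF assms, of "\<lambda>M. M $$ (0, 2)"] arg_cong[OF assms, of "\<lambda>M. M $$ (1, 0)"]
    arg_cong[OF assms, of "\<lambda>M. M $$ (1, 1)"] arg_cong[OF assms, of "\<lambda>M. M $$ (1, 2)"]
    arg_cong[OF assms, of "\<lambda>M. M $$ (2, 0)"] arg_cong[OF assms, of "\<lambda>M. M $$ (2, 1)"]
    arg_cong[OF assms, of "\<lambda>M. M $$ (2, 2)"]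
  unfolding magic_square_index by (intro exI[of _ "a' - a"]) linarith

lemma represents_unique:
  assumes "represents A (U, V) \<delta>" "represents A (U', V') \<delta>'"
  shows "\<delta>' = \<delta> \<and> (\<exists>t. U' = image_mset (\<lambda>x. x + t) U \<and> V' = image_mset (\<lambda>x. x + t) V)"
proof -
  obtain a b c p q r where UV: "U = {#a, b, c#}" "V = {#p, q, r#}" and \<delta>: "\<delta> \<ge> 0" and
    A: "A = (magic_square a b c p q r, magic_square (a + \<delta>) (b + \<delta>) (c + \<delta>) p q r) \<or>
      A = (magic_square (a + \<delta>) (b + \<delta>) (c + \<delta>) p q r, magic_square a b c p q r)"
    using assms(1) unfolding represents_def by blast
  obtain a' b' c' p' q' r' where UV': "U' = {#a', b', c'#}" "V' = {#p', q', r'#}" and \<delta>': "\<delta>' \<ge> 0" and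
    A': "A = (magic_square a' b' c' p' q' r', magic_square (a' + \<delta>') (b' + \<delta>') (c' + \<delta>') p' q' r') \<or>
      A = (magic_square (a' + \<delta>') (b' + \<delta>') (c' + \<delta>') p' q' r', magic_square a' b' c' p' q' r')"
    using assms(2) unfolding represents_def by blast
  have "(magic_square a b c p q r = magic_square a' b' c' p' q' r' \<and>
      magic_square (a + \<delta>) (b + \<delta>) (c + \<delta>) p q r = magic_square (a' + \<delta>') (b' + \<delta>') (c' + \<delta>') p' q' r') \<or>
    (magic_square a b c p q r = magic_square (a' + \<delta>') (b' + \<delta>') (c' + \<delta>') p' q' r' \<and>
      magic_square (a + \<delta>) (b + \<delta>) (c + \<delta>) p q r = magic_square a' b' c' p' q' r')"
    using A A' by auto
  then have "\<delta>' = \<delta> \<and> (\<exists>t. a' = a + t \<and> b' = b + t \<and> c' = c + t \<and> p' = p + t \<and> q' = q + t \<and> r' = r + t)"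
  proof (elim disjE conjE)
    assume 1: "magic_square a b c p q r = magic_square a' b' c' p' q' r'"
      "magic_square (a + \<delta>) (b + \<delta>) (c + \<delta>) p q r = magic_square (a' + \<delta>') (b' + \<delta>') (c' + \<delta>') p' q' r'"
    show ?thesis using magic_square_eqD[OF 1(1)] magic_square_eqD[OF 1(2)] by auto
  next
    assume 1: "magic_square a b c p q r = magic_square (a' + \<delta>') (b' + \<delta>') (c' + \<delta>') p' q' r'"
      "magic_square (a + \<delta>) (b + \<delta>) (c + \<delta>) p q r = magic_square a' b' c' p' q' r'"
    obtain t s where "a' + \<delta>' = a + t" "p' = p + t" "a' = a + \<delta> + s" "p' = p + s"
      using magic_square_eqD[OF 1(1)] magic_square_eqD[OF 1(2)] by auto
    \<comment> \<open>Here the two squares have changed roles. The equations for \<open>p'\<close>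
      give \<open>t = s\<close>, and those for \<open>a'\<close> then give
      \<open>\<delta> + \<delta>' = 0\<close>.\<close>
    then have "\<delta>' = 0" "\<delta> = 0" using \<delta> \<delta>' by linarith+
    then show ?thesis using magic_square_eqD[OF 1(1)] by simp
  qed
  then show ?thesis by (auto simp: UV UV')
qed

text \<open>Multisets forget the order, which the operations do not respect, but keep repetitions,
  which matter for sums and products.\<close>

definition upper_xis :: "params \<Rightarrow> real multiset" where
  "upper_xis m = image_mset (xi m) (mset_set {1..3})"

definition lower_xis :: "params \<Rightarrow> real multiset" where
  "lower_xis m = image_mset (xi m) (mset_set {4..6})"

lemma atLeastAtMost_triples: "{1..3::nat} = {1, 2, 3}" "{4..6::nat} = {4, 5, 6}"
  by auto

lemma xis_eq:
  "upper_xis m = {#xi m 1, xi m 2, xi m 3#}"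
  "lower_xis m = {#xi m 4, xi m 5, xi m 6#}"
  unfolding upper_xis_def lower_xis_def atLeastAtMost_triples by simp_all

lemma represents_Arr: "represents (Arr m) (upper_xis m, lower_xis m) \<bar>ell m - enn m\<bar>"
proof -
  obtain m1 m2 m1' m2' m1'' m2'' where m: "m = (m1, m2, m1', m2', m1'', m2'')"
    by (cases m) auto
  define l n where "l = ell m" and "n = enn m"
  \<comment> \<open>With these two parameters eliminated, all entries are linear in
    \<open>l\<close>, \<open>n\<close> and the other four.\<close>
  have m1'': "real_of_int m1'' = m1 + m1' + l - 2 * n" and m2'': "real_of_int m2'' = m2 + m2' + n - 2 * l"
    by (simp_all add: l_def n_def m field_simps)
  have Arr: "Arr m = (mat_of_rows_list 3
            [[real_of_int m1, real_of_int m1', real_of_int m2''],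
             [m1' + m2' - l,  m1 + m2 - l,     n],
             [m2 + n - l,     m2' + n - l,     m1'' + n - l]],
          mat_of_rows_list 3
            [[m1 + l - n,     m1' + l - n,     m2'' + l - n],
             [m1' + m2' - n,  m1 + m2 - n,     l],
             [real_of_int m2, real_of_int m2', real_of_int m1'']])"
    unfolding l_def n_def by (simp add: m Let_def)
  have xi: "xi m i = ((if l \<le> n then [l, m2, m1' + l - n] else [n, m1', m2 + n - l])
          @ [l - m2', n - m1, 0]) ! (i - 1)" for i
    unfolding l_def n_def by (simp add: m Let_def)
  show ?thesis
  proof (cases "l \<le> n")
    case True
    \<comment> \<open>The right square is the smaller one. The triples are listed in the orders 1,
      3, 2 and 5, 6, 4 of the \<xi>, as the layout of \<open>magic_square\<close> requires.\<close>
    have "represents (Arr m) ({#l, m1' + l - n, m2#}, {#n - m1, 0, l - m2'#}) (n - l)"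
      unfolding Arr m1'' m2'' using True
      by (intro representsI disjI2) (simp_all add: magic_square_def algebra_simps)
    moreover have "upper_xis m = {#l, m1' + l - n, m2#}" "lower_xis m = {#n - m1, 0, l - m2'#}"
      using True by (simp_all add: xis_eq xi add_mset_commute)
    ultimately show ?thesis using True by (simp add: l_def n_def)
  next
    case False
    have "represents (Arr m) ({#n, m1', m2 + n - l#}, {#n - m1, 0, l - m2'#}) (l - n)"
      unfolding Arr m1'' m2'' using False
      by (intro representsI disjI1) (simp_all add: magic_square_def algebra_simps)
    moreover have "upper_xis m = {#n, m1', m2 + n - l#}" "lower_xis m = {#n - m1, 0, l - m2'#}"
      using False by (simp_all add: xis_eq xi add_mset_commute)
    ultimately show ?thesis using False by (simp add: l_def n_def)
  qed
qed

section \<open>The matrices under translation and reflection of the parameters\<close>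

text \<open>Transports symmetric expressions between parameter sets. The index sets may differ, as
  the reflection exchanges \<open>{1..3}\<close> and \<open>{4..6}\<close>.\<close>

lemma sum_cong_mset:
  assumes "image_mset f (mset_set I) = image_mset g (mset_set J)"
  shows "(\<Sum>i\<in>I. h (f i)) = (\<Sum>j\<in>J. h (g j))"
  using arg_cong[OF assms, of "\<lambda>M. sum_mset (image_mset h M)"]
  by (simp add: sum_unfold_sum_mset multiset.map_comp comp_def)

lemma prod_cong_mset:
  assumes "image_mset f (mset_set I) = image_mset g (mset_set J)"
  shows "(\<Prod>i\<in>I. h (f i)) = (\<Prod>j\<in>J. h (g j))"
  using arg_cong[OF assms, of "\<lambda>M. prod_mset (image_mset h M)"]
  by (simp add: prod_unfold_prod_mset multiset.map_comp comp_def)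

lemma image_cong_mset:
  assumes "image_mset f (mset_set I) = image_mset g (mset_set J)" "finite I" "finite J"
  shows "f ` I = g ` J"
  using arg_cong[OF assms(1), of set_mset] assms(2,3) by simp

lemma Min_image_minus:
  fixes f :: "'a \<Rightarrow> real"
  assumes "finite S" "S \<noteq> {}"
  shows "Min ((\<lambda>x. t - f x) ` S) = t - Max (f ` S)"
    and "Max ((\<lambda>x. t - f x) ` S) = t - Min (f ` S)"
proof -
  have "Max (f ` S) \<in> f ` S" "Min (f ` S) \<in> f ` S" using assms by auto
  then obtain x y where "x \<in> S" "Max (f ` S) = f x" "y \<in> S" "Min (f ` S) = f y" by blast
  moreover have "f z \<le> Max (f ` S)" "Min (f ` S) \<le> f z" if "z \<in> S" for z
    using assms that by auto
  ultimately show "Min ((\<lambda>x. t - f x) ` S) = t - Max (f ` S)" "Max ((\<lambda>x. t - f x) ` S) = t - Min (f ` S)"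
    using assms(1) by (auto intro!: Min_eqI Max_eqI)
qed

lemma sum_one_to_six:
  fixes f :: "nat \<Rightarrow> real"
  shows "(\<Sum>i=1..6. f i) = (\<Sum>i=1..3. f i) + (\<Sum>i=4..6. f i)"
proof -
  have "{1..6::nat} = {1..3} \<union> {4..6}" by auto
  then show ?thesis by (simp only:) (rule sum.union_disjoint, auto)
qed

text \<open>Reversing the basis turns the step from \<open>j\<close> to \<open>j + 1\<close> into
  the step from \<open>d + 1 - j\<close> to \<open>d - j\<close>, so upper and lower entries trade
  places with index \<open>d - j\<close>. The factor \<open>c\<close> is -1 for \<open>X\<close> and
  1 for \<open>Y\<close>.\<close>

lemma tridiagonal_reflect:
  assumes up: "\<And>j. 1 \<le> j \<Longrightarrow> j < d \<Longrightarrow> upper' j = c * lower (d - j)"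
    and low: "\<And>j. 1 \<le> j \<Longrightarrow> j < d \<Longrightarrow> lower' j = c * upper (d - j)"
    and diag: "\<And>j. 1 \<le> j \<Longrightarrow> j \<le> d \<Longrightarrow> diag' j = c * diag (d + 1 - j)"
    and rs: "r < d" "s < d"
  shows "tridiagonal d lower' diag' upper' $$ (r, s) =
    complex_of_real c * tridiagonal d lower diag upper $$ (d - 1 - r, d - 1 - s)"
proof -
  consider "s = r + 1" | "r = s + 1" | "r = s" | "s \<noteq> r + 1" "r \<noteq> s + 1" "r \<noteq> s" by blast
  then show ?thesis
  proof cases
    case 1
    have "d - 1 - r = (d - 1 - s) + 1" "d - 1 - s + 1 = d - (r + 1)" using 1 rs by auto
    then show ?thesis using 1 rs up[of "r + 1"] by (simp add: tridiagonal_def)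
  next
    case 2
    have "d - 1 - s = (d - 1 - r) + 1" "d - 1 - r + 1 = d - (s + 1)" using 2 rs by auto
    then show ?thesis using 2 rs low[of "s + 1"] by (simp add: tridiagonal_def)
  next
    case 3
    have "d - 1 - r + 1 = d + 1 - (r + 1)" using rs by auto
    then show ?thesis using 3 rs diag[of "r + 1"] by (simp add: tridiagonal_def)
  next
    case 4
    have "d - 1 - s \<noteq> (d - 1 - r) + 1" "d - 1 - r \<noteq> (d - 1 - s) + 1" "d - 1 - r \<noteq> d - 1 - s"
      using 4 rs by auto
    then show ?thesis using 4 rs by (simp add: tridiagonal_def)
  qed
qed

section \<open>Translation of the parameters, for sign 1\<close>

locale shifted_params =
  fixes m m' :: params and t :: real
  assumes up: "upper_xis m' = image_mset (\<lambda>x. x + t) (upper_xis m)"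
    and low: "lower_xis m' = image_mset (\<lambda>x. x + t) (lower_xis m)"
    and dist: "\<bar>ell m' - enn m'\<bar> = \<bar>ell m - enn m\<bar>"
begin

lemma up': "image_mset (xi m') (mset_set {1..3}) = image_mset (\<lambda>i. xi m i + t) (mset_set {1..3})"
  using up by (simp add: upper_xis_def multiset.map_comp comp_def)

lemma low': "image_mset (xi m') (mset_set {4..6}) = image_mset (\<lambda>i. xi m i + t) (mset_set {4..6})"
  using low by (simp add: lower_xis_def multiset.map_comp comp_def)

lemma xi_a_eq: "xi_a m' = xi_a m + t"
proof -
  have "Min ((\<lambda>i. xi m i + t) ` {1..3}) = Min (xi m ` {1..3}) + t"
    by (rule Min_add_commute) auto
  then show ?thesis
    unfolding xi_a_def using image_cong_mset[OF up'] by simp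
qed

lemma xi_b_eq: "xi_b m' = xi_b m + t"
proof -
  have "Max ((\<lambda>i. xi m i + t) ` {4..6}) = Max (xi m ` {4..6}) + t"
    by (rule Max_add_commute) auto
  then show ?thesis
    unfolding xi_b_def using image_cong_mset[OF low'] by simp
qed

text \<open>Three \<xi> enter with plus and three with minus, so the translation cancels.\<close>

lemma Lam_eq: "Lam m' = Lam m"
  unfolding Lam_def sum_cong_mset[OF up', of "\<lambda>x. x"] sum_cong_mset[OF low', of "\<lambda>x. x"] dist
  by (simp add: sum.distrib)

lemma lam_eq: "lam_plus m' = lam_plus m + t" "lam_minus m' = lam_minus m + t"
  unfolding lam_plus_def lam_minus_def Lam_eq sum_one_to_six
    sum_cong_mset[OF up', of "\<lambda>x. x"] sum_cong_mset[OF low', of "\<lambda>x. x"]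
  by (simp_all add: sum.distrib)

lemma E_eq: "E m' j k = E m j k"
  unfolding E_def xi_b_eq sum_one_to_six
    sum_cong_mset[OF up', of "\<lambda>x. (x - real j - (xi_b m + t) + 1 / 2) ^ k"]
    sum_cong_mset[OF low', of "\<lambda>x. (x - real j - (xi_b m + t) + 1 / 2) ^ k"]
  by (simp add: algebra_simps)

lemma a_eq: "a_upper m' j = a_upper m j" "a_lower m' j = a_lower m j"
  unfolding a_upper_def a_lower_def xi_b_eq
    prod_cong_mset[OF up', of "\<lambda>x. real j + (xi_b m + t) - x"]
    prod_cong_mset[OF low', of "\<lambda>x. real j + (xi_b m + t) - x"]
  by (simp_all add: algebra_simps)

lemma X_eq: "X_mat m' = X_mat m"
proof -
  have "a_diag m' = a_diag m" by (rule ext) (simp add: a_diag_def E_eq Lam_eq)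
  moreover have "a_upper m' = a_upper m" "a_lower m' = a_lower m" by (rule ext, rule a_eq)+
  ultimately show ?thesis by (simp add: X_mat_def msize_def xi_a_eq xi_b_eq)
qed

lemma Y_eq: "Y_mat m' = Y_mat m"
proof -
  have "b_diag m' = b_diag m" by (rule ext) (simp add: b_diag_def E_eq Lam_eq)
  moreover have "b_upper m' = b_upper m" "b_lower m' = b_lower m"
    by (rule ext, simp add: b_upper_def b_lower_def a_eq lam_eq xi_b_eq)+
  ultimately show ?thesis by (simp add: Y_mat_def msize_def xi_a_eq xi_b_eq)
qed

end

section \<open>Reflection of the parameters, for sign -1\<close>

locale reflected_params =
  fixes m m' :: params and t :: real
  assumes up: "upper_xis m' = image_mset (\<lambda>x. t - x) (lower_xis m)"
    and low: "lower_xis m' = image_mset (\<lambda>x. t - x) (upper_xis m)"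
    and dist: "\<bar>ell m' - enn m'\<bar> = \<bar>ell m - enn m\<bar>"
    and int: "xi_a m - xi_b m \<in> \<int>"
begin

lemma up': "image_mset (xi m') (mset_set {1..3}) = image_mset (\<lambda>i. t - xi m i) (mset_set {4..6})"
  using up by (simp add: upper_xis_def lower_xis_def multiset.map_comp comp_def)

lemma low': "image_mset (xi m') (mset_set {4..6}) = image_mset (\<lambda>i. t - xi m i) (mset_set {1..3})"
  using low by (simp add: upper_xis_def lower_xis_def multiset.map_comp comp_def)

lemma xi_a_eq: "xi_a m' = t - xi_b m"
  unfolding xi_a_def xi_b_def using image_cong_mset[OF up'] by (simp add: Min_image_minus)

lemma xi_b_eq: "xi_b m' = t - xi_a m"
  unfolding xi_a_def xi_b_def using image_cong_mset[OF low'] by (simp add: Min_image_minus)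

lemma msize_eq: "msize m' = msize m"
  by (simp add: msize_def xi_a_eq xi_b_eq)

text \<open>Integrality makes the floor exact, and an index below the size shows that
  \<open>nat\<close> has not cut off a negative value.\<close>

lemma real_msize:
  assumes "j < msize m" shows "xi_a m = xi_b m + real (msize m)"
proof -
  obtain z where z: "xi_a m - xi_b m = of_int z" using int by (auto elim: Ints_cases)
  then have "real (msize m) = of_int z" using assms by (simp add: msize_def)
  then show ?thesis using z by simp
qed

lemma Lam_eq: "Lam m' = Lam m"
  unfolding Lam_def sum_cong_mset[OF up', of "\<lambda>x. x"] sum_cong_mset[OF low', of "\<lambda>x. x"] dist
  by (simp add: sum_subtractf)

text \<open>\<open>Lam\<close> is unchanged while the mean of the six \<xi> is reflected, so the two
  values trade places.\<close>

lemma lam_eq: "lam_plus m' = t - lam_minus m" "lam_minus m' = t - lam_plus m"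
  unfolding lam_plus_def lam_minus_def Lam_eq sum_one_to_six
    sum_cong_mset[OF up', of "\<lambda>x. x"] sum_cong_mset[OF low', of "\<lambda>x. x"]
  by (simp_all add: sum_subtractf field_simps)

text \<open>Thanks to the summand 1/2, the base of each power changes sign exactly when
  \<open>j\<close> becomes \<open>msize m + 1 - j\<close>.\<close>

lemma E_eq:
  assumes "1 \<le> j" "j \<le> msize m"
  shows "E m' j k = (- 1) ^ k * E m (msize m + 1 - j) k"
proof -
  have d: "xi_a m = xi_b m + real (msize m)" using real_msize[of "j - 1"] assms by auto
  have j: "real (msize m + 1 - j) = real (msize m) + 1 - real j" using assms by auto
  have "(t - xi m i - real j - (t - xi_a m) + 1 / 2) ^ k =
     (- 1) ^ k * (xi m i - real (msize m + 1 - j) - xi_b m + 1 / 2) ^ k" for i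
    unfolding power_mult_distrib[symmetric] j d by (simp add: algebra_simps)
  then show ?thesis
    unfolding E_def xi_b_eq sum_one_to_six
      sum_cong_mset[OF up', of "\<lambda>x. (x - real j - (t - xi_a m) + 1 / 2) ^ k"]
      sum_cong_mset[OF low', of "\<lambda>x. (x - real j - (t - xi_a m) + 1 / 2) ^ k"]
    by (simp add: sum_distrib_left distrib_left)
qed

text \<open>Each of the three factors changes sign.\<close>

lemma a_eq:
  assumes "1 \<le> j" "j < msize m"
  shows "a_upper m' j = - a_lower m (msize m - j)" "a_lower m' j = - a_upper m (msize m - j)"
proof -
  have d: "xi_a m = xi_b m + real (msize m)" using real_msize[OF assms(2)] .
  have factor: "real j + (t - xi_a m) - (t - xi m i) = - 1 * (real (msize m - j) + xi_b m - xi m i)" for i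
    using assms by (simp add: d algebra_simps)
  have "(\<Prod>i\<in>I. real j + (t - xi_a m) - (t - xi m i)) =
     (- 1) ^ card I * (\<Prod>i\<in>I. real (msize m - j) + xi_b m - xi m i)" for I
    unfolding factor prod.distrib by simp
  then show "a_upper m' j = - a_lower m (msize m - j)" "a_lower m' j = - a_upper m (msize m - j)"
    unfolding a_upper_def a_lower_def xi_b_eq
      prod_cong_mset[OF up', of "\<lambda>x. real j + (t - xi_a m) - x"]
      prod_cong_mset[OF low', of "\<lambda>x. real j + (t - xi_a m) - x"]
    by simp_all
qed

text \<open>The fourth factor changes sign as well, so the signs cancel.\<close>

lemma b_eq:
  assumes "1 \<le> j" "j < msize m"
  shows "b_upper m' j = b_lower m (msize m - j)" "b_lower m' j = b_upper m (msize m - j)"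
proof -
  have d: "xi_a m = xi_b m + real (msize m)" using real_msize[OF assms(2)] .
  have "real j + xi_b m' - lam_minus m' = - (real (msize m - j) + xi_b m - lam_plus m)"
    "real j + xi_b m' - lam_plus m' = - (real (msize m - j) + xi_b m - lam_minus m)"
    using assms by (simp_all add: d lam_eq xi_b_eq)
  then show "b_upper m' j = b_lower m (msize m - j)" "b_lower m' j = b_upper m (msize m - j)"
    by (simp_all only: b_upper_def b_lower_def a_eq[OF assms] minus_mult_minus)
qed

text \<open>If \<open>E m j k\<close> has weight \<open>k\<close>, all terms of
  \<open>a_diag\<close> have odd weight and all terms of \<open>b_diag\<close> even weight.\<close>

lemma diag_eq:
  assumes "1 \<le> j" "j \<le> msize m"
  shows "a_diag m' j = - a_diag m (msize m + 1 - j)" "b_diag m' j = b_diag m (msize m + 1 - j)"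
  by (simp_all add: a_diag_def b_diag_def E_eq[OF assms] Lam_eq algebra_simps)

lemma X_eq:
  assumes "r < msize m" "s < msize m"
  shows "X_mat m' $$ (r, s) = - X_mat m $$ (msize m - 1 - r, msize m - 1 - s)"
  using tridiagonal_reflect[of "msize m" "a_upper m'" "- 1" "a_lower m" "a_lower m'" "a_upper m"
      "a_diag m'" "a_diag m", OF _ _ _ assms] a_eq diag_eq(1)
  by (simp add: X_mat_def msize_eq)

lemma Y_eq:
  assumes "r < msize m" "s < msize m"
  shows "Y_mat m' $$ (r, s) = Y_mat m $$ (msize m - 1 - r, msize m - 1 - s)"
  using tridiagonal_reflect[of "msize m" "b_upper m'" 1 "b_lower m" "b_lower m'" "b_upper m"
      "b_diag m'" "b_diag m", OF _ _ _ assms] b_eq diag_eq(2)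
  by (simp add: Y_mat_def msize_eq)

end

section \<open>Conjugation by the reversal, integrality and conclusion\<close>

definition reversal_mat :: "nat \<Rightarrow> complex mat" where
  "reversal_mat d = mat d d (\<lambda>(r, s). if r + s + 1 = d then 1 else 0)"

lemma reversal_mat_mult:
  assumes "B \<in> carrier_mat d d"
  shows "reversal_mat d * B = mat d d (\<lambda>(r, s). B $$ (d - 1 - r, s))"
    and "B * reversal_mat d = mat d d (\<lambda>(r, s). B $$ (r, d - 1 - s))"
proof -
  have eq: "(Suc (r + i) = d) = (i = d - 1 - r)" "(Suc (i + r) = d) = (i = d - 1 - r)" if "r < d" for i r
    using that by auto
  show "reversal_mat d * B = mat d d (\<lambda>(r, s). B $$ (d - 1 - r, s))"
    using assms by (intro eq_matI) (auto simp: reversal_mat_def scalar_prod_def eq if_distribR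
        if_distrib[of "\<lambda>x. x * _"] cong: if_cong)
  show "B * reversal_mat d = mat d d (\<lambda>(r, s). B $$ (r, d - 1 - s))"
    using assms by (intro eq_matI) (auto simp: reversal_mat_def scalar_prod_def eq
        if_distrib[of "\<lambda>x. _ * x"] cong: if_cong)
qed

text \<open>The reversal is its own inverse, so the same matrix serves on both sides, and for
  \<open>X\<close> and \<open>Y\<close> alike.\<close>

lemma similar_reversal:
  assumes "A \<in> carrier_mat d d" "B \<in> carrier_mat d d"
    and "\<And>r s. r < d \<Longrightarrow> s < d \<Longrightarrow> B $$ (r, s) = A $$ (d - 1 - r, d - 1 - s)"
  shows "similar_mat_wit A B (reversal_mat d) (reversal_mat d)"
proof (rule similar_mat_witI)
  have J: "reversal_mat d \<in> carrier_mat d d" by (simp add: reversal_mat_def)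
  show "reversal_mat d * reversal_mat d = 1\<^sub>m d"
    unfolding reversal_mat_mult(1)[OF J] by (intro eq_matI) (auto simp: reversal_mat_def)
  then show "reversal_mat d * reversal_mat d = 1\<^sub>m d" .
  show "A = reversal_mat d * B * reversal_mat d"
    unfolding reversal_mat_mult(1)[OF assms(2)]
    using assms by (subst reversal_mat_mult(2)) (auto intro!: eq_matI)
qed (use assms in \<open>auto simp: reversal_mat_def\<close>)

lemma similar_mat_wit_one:
  assumes "A \<in> carrier_mat d d"
  shows "similar_mat_wit A A (1\<^sub>m d) (1\<^sub>m d)"
  using assms by (intro similar_mat_witI[where n = d]) auto

lemma X_Y_carrier:
  "X_mat m \<in> carrier_mat (msize m) (msize m)" "Y_mat m \<in> carrier_mat (msize m) (msize m)"
  by (simp_all add: X_mat_def Y_mat_def tridiagonal_def)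

text \<open>Divisibility by 3 settles \<open>ell m\<close>, and \<open>ell m + enn m\<close> is
  always an integer.\<close>

lemma tensor_multiplicity_Ints:
  assumes "tensor_multiplicity m d" "d > 0"
  shows "ell m \<in> \<int>" "enn m \<in> \<int>"
proof -
  obtain m1 m2 m1' m2' m1'' m2'' where m: "m = (m1, m2, m1', m2', m1'', m2'')"
    by (cases m) auto
  obtain s where s: "(m1 + 2 * m2) + (m1' + 2 * m2') - (m1'' + 2 * m2'') = 3 * s"
    using tensor_multiplicity_triality assms unfolding m by blast
  have "real_of_int ((m1 + 2 * m2) + (m1' + 2 * m2') - (m1'' + 2 * m2'')) = real_of_int (3 * s)"
    unfolding s ..
  then have "ell m = real_of_int s" by (simp add: m)
  moreover have "enn m = real_of_int (m1 + m2 + m1' + m2' - m1'' - m2'') - ell m"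
    by (simp add: m field_simps)
  ultimately show "ell m \<in> \<int>" "enn m \<in> \<int>" by auto
qed

lemma xi_a_minus_xi_b_Ints:
  assumes "ell m \<in> \<int>" "enn m \<in> \<int>"
  shows "xi_a m - xi_b m \<in> \<int>"
proof -
  obtain m1 m2 m1' m2' m1'' m2'' where m: "m = (m1, m2, m1', m2', m1'', m2'')"
    by (cases m) auto
  have "xi m i \<in> \<int>" if "i \<in> {1, 2, 3, 4, 5, 6}" for i
    using assms that unfolding m by (auto simp: Let_def simp del: ell.simps enn.simps)
  then have "xi m ` {1..3} \<subseteq> \<int>" "xi m ` {4..6} \<subseteq> \<int>"
    unfolding atLeastAtMost_triples by auto
  moreover have "xi_a m \<in> xi m ` {1..3}" "xi_b m \<in> xi m ` {4..6}"
    unfolding xi_a_def xi_b_def by (auto intro!: Min_in Max_in simp del: atLeastAtMost_iff)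
  ultimately show ?thesis by (intro Ints_diff) blast+
qed

theorem theorem2p1:
  fixes m mt :: params and d :: nat and ops :: "arr_op list"
  assumes "positive_params m"
    and "tensor_multiplicity m d" and "d > 0"
    and "\<forall>op \<in> set ops. valid_op op"
    and "Arr mt = apply_ops ops (Arr m)"
  shows "\<exists>P Q. similar_mat_wit (X_mat m) (of_int (ops_sign ops) \<cdot>\<^sub>m X_mat mt) P Q \<and>
               similar_mat_wit (Y_mat m) (Y_mat mt) P Q"
proof -
  obtain U V where UV: "flip_sign (ops_sign ops) (upper_xis m, lower_xis m) = (U, V)"
    by (cases "flip_sign (ops_sign ops) (upper_xis m, lower_xis m)") auto
  have "represents (Arr mt) (U, V) \<bar>ell m - enn m\<bar>"
    using represents_apply_ops[OF assms(4) represents_Arr[of m]] UV assms(5) by simp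
  \<comment> \<open>\<open>Arr mt\<close> is read in two ways: from the \<xi> of \<open>m\<close>
    carried through the operations, and from those of \<open>mt\<close>. They agree up to a
    translation \<open>t\<close>.\<close>
  from represents_unique[OF this represents_Arr[of mt]]
  obtain t where dist: "\<bar>ell mt - enn mt\<bar> = \<bar>ell m - enn m\<bar>"
    and mt: "upper_xis mt = image_mset (\<lambda>x. x + t) U" "lower_xis mt = image_mset (\<lambda>x. x + t) V"
    by blast
  consider "ops_sign ops = 1" | "ops_sign ops = - 1" using ops_sign_in[of ops] by blast
  then show ?thesis
  proof cases
    case 1
    then have "U = upper_xis m" "V = lower_xis m" using UV by (auto simp: flip_sign_def)
    then interpret shifted_params m mt t using mt dist by unfold_locales simp_all
    have "of_int (ops_sign ops) \<cdot>\<^sub>m X_mat mt = X_mat m"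
      using 1 by (auto simp: X_eq)
    then show ?thesis
      using similar_mat_wit_one[OF X_Y_carrier(1)[of m]] similar_mat_wit_one[OF X_Y_carrier(2)[of m]] Y_eq
      by auto
  next
    case 2
    then have "U = image_mset uminus (lower_xis m)" "V = image_mset uminus (upper_xis m)"
      using UV by (auto simp: flip_sign_def)
    \<comment> \<open>Negation followed by translation by \<open>t\<close> is the reflection
      \<open>x \<mapsto> t - x\<close>.\<close>
    then interpret reflected_params m mt t
      using mt dist xi_a_minus_xi_b_Ints[OF tensor_multiplicity_Ints[OF assms(2,3)]]
      by unfold_locales (simp_all add: multiset.map_comp comp_def)
    note carr = X_Y_carrier[of m] X_Y_carrier[of mt, unfolded msize_eq]
    \<comment> \<open>The sign produced by the reversal cancels against
      \<open>ops_sign ops = - 1\<close>.\<close>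
    have "similar_mat_wit (X_mat m) (of_int (ops_sign ops) \<cdot>\<^sub>m X_mat mt)
        (reversal_mat (msize m)) (reversal_mat (msize m))"
      using carr X_eq 2 by (intro similar_reversal) auto
    moreover have "similar_mat_wit (Y_mat m) (Y_mat mt)
        (reversal_mat (msize m)) (reversal_mat (msize m))"
      using carr Y_eq by (intro similar_reversal) auto
    ultimately show ?thesis by blast
  qed
qed

end
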